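(* All finitely generated abelian groups have logspace normal form functions. In the case of $\mathbb{Z}^n$, if $t_1,t_2,\dots,t_n$ is a set of free generators, the normal forms (computable in logspace) are of the form $t_1^{\alpha_1}t_2^{\alpha_2}\cdots t_n^{\alpha_n}$ with $\alpha_i\in\mathbb{Z}$.
   Context: A deterministic logspace transducer is a deterministic machine with a finite state control and three tapes: a read-only input tape storing the input word; a read-write work tape restricted to at most $c\log n$ squares, where $n$ is the length of the input word and $c$ is a fixed constant; and a write-only output tape written from left to right. In each transition it may modify the work tape, change state, move the input read-head, and write at most a fixed constant number of letters to the output tape. For finite alphabets $X,Y$, a function $f:X^*\to Y^*$ is logspace computable if some deterministic logspace transducer outputs $f(w)$ on every input $w\in X^*$ ($X^*$ is the set of finite words over $X$, including the empty word $\lambda$). Let $G$ be a group with finite symmetric (closed under inverses) generating set $X$; for $w\in X^*$ let $\overline{w}\in G$ denote the element it represents. A normal form for $(G,X)$ is a subset $L\subseteq X^*$ such that $w\mapsto\overline{w}$ restricts to a bijection $L\to G$. A logspace normal form function for $(G,X)$ is a logspace computable $f:X^*\to X^*$ such that, for some normal form $L$, $f(w)$ is the unique element of $L$ with $\overline{f(w)}=\overline{w}$, for all $w\in X^*$. $G$ has a logspace normal form function if $(G,X)$ does for some finite symmetric generating set $X$. In the second sentence of the claim the generating set is $\{t_1^{\pm1},\dots,t_n^{\pm1}\}$, and $L=\{t_1^{\alpha_1}\cdots t_n^{\alpha_n}\mid\alpha_i\in\mathbb{Z}\}$. *)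

theory Defs
  imports Complex_Main "HOL-Algebra.FiniteProduct" "HOL-Algebra.Generated_Groups" "HOL-Algebra.Product_Groups"
begin

section \<open>Deterministic logspace transducers\<close>

datatype move = Left | Stay | Right

text \<open>
  The input word is delimited by two end markers. The input head ranges over the positions
  \<open>0, ..., length w + 1\<close> only, so that its position carries no more than logarithmically many
  bits of information.
\<close>

datatype 'x cell = Left_End | Letter 'x | Right_End

definition input_cell :: "'x list \<Rightarrow> nat \<Rightarrow> 'x cell" where
  "input_cell w i =
     (if i = 0 then Left_End else if i \<le> length w then Letter (w ! (i - 1)) else Right_End)"

fun move_input :: "'x list \<Rightarrow> move \<Rightarrow> nat \<Rightarrow> nat" where
  "move_input w Left i = i - 1"
| "move_input w Stay i = i"
| "move_input w Right i = min (i + 1) (length w + 1)"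

text \<open>The work tape is infinite to the right; a left move on square \<open>0\<close> leaves the head there.\<close>

fun move_work :: "move \<Rightarrow> nat \<Rightarrow> nat" where
  "move_work Left h = h - 1"
| "move_work Stay h = h"
| "move_work Right h = h + 1"

text \<open>
  States and work tape symbols are natural numbers, which is no restriction as there are only
  finitely many of them. A transition, determined by the state, the scanned input cell and the
  scanned work symbol, yields the new state, the work symbol written, the moves of the input head
  and of the work head, and the word appended to the output. The machine halts when \<open>transition\<close>
  is \<open>None\<close>.
\<close>

record ('x, 'y) transducer =
  states :: "nat set"
  initial :: nat
  work_symbols :: "nat set"
  blank :: nat
  transition :: "nat \<Rightarrow> 'x cell \<Rightarrow> nat \<Rightarrow> (nat \<times> nat \<times> move \<times> move \<times> 'y list) option"

definition is_transducer :: "'x set \<Rightarrow> 'y set \<Rightarrow> ('x, 'y) transducer \<Rightarrow> bool" where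
  "is_transducer X Y M \<longleftrightarrow>
     finite (states M) \<and> initial M \<in> states M \<and>
     finite (work_symbols M) \<and> blank M \<in> work_symbols M \<and>
     (\<exists>b. \<forall>q \<in> states M. \<forall>a \<in> {Left_End, Right_End} \<union> Letter ` X. \<forall>s \<in> work_symbols M.
        \<forall>q' s' d e u. transition M q a s = Some (q', s', d, e, u) \<longrightarrow>
          q' \<in> states M \<and> s' \<in> work_symbols M \<and> u \<in> lists Y \<and> length u \<le> b)"

record 'y config =
  state :: nat
  input_head :: nat
  work_tape :: "nat \<Rightarrow> nat"
  work_head :: nat
  written :: "'y list"

definition initial_config :: "('x, 'y) transducer \<Rightarrow> 'y config" where
  "initial_config M =
     \<lparr>state = initial M, input_head = 0, work_tape = (\<lambda>_. blank M), work_head = 0, written = []\<rparr>"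

definition current_transition ::
    "('x, 'y) transducer \<Rightarrow> 'x list \<Rightarrow> 'y config \<Rightarrow> (nat \<times> nat \<times> move \<times> move \<times> 'y list) option"
where
  "current_transition M w C =
     transition M (state C) (input_cell w (input_head C)) (work_tape C (work_head C))"

inductive step :: "('x, 'y) transducer \<Rightarrow> 'x list \<Rightarrow> 'y config \<Rightarrow> 'y config \<Rightarrow> bool"
  for M w where
  "current_transition M w C = Some (q, s, d, e, u) \<Longrightarrow>
     step M w C
       \<lparr>state = q,
        input_head = move_input w d (input_head C),
        work_tape = (work_tape C)(work_head C := s),
        work_head = move_work e (work_head C),
        written = written C @ u\<rparr>"

definition reachable :: "('x, 'y) transducer \<Rightarrow> 'x list \<Rightarrow> 'y config \<Rightarrow> bool" where
  "reachable M w = (step M w)\<^sup>*\<^sup>* (initial_config M)"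

definition halts_with_output :: "('x, 'y) transducer \<Rightarrow> 'x list \<Rightarrow> 'y list \<Rightarrow> bool" where
  "halts_with_output M w v \<longleftrightarrow>
     (\<exists>C. reachable M w C \<and> current_transition M w C = None \<and> written C = v)"

text \<open>
  The bound is \<open>c log n\<close> for \<open>n \<ge> 2\<close>; since \<open>log n\<close> is zero or undefined for \<open>n < 2\<close>, the
  bound there is the constant \<open>c\<close>. The base of the logarithm is immaterial.
\<close>

definition logspace_bounded :: "'x set \<Rightarrow> ('x, 'y) transducer \<Rightarrow> bool" where
  "logspace_bounded X M \<longleftrightarrow>
     (\<exists>c::nat. \<forall>w \<in> lists X. \<forall>C. reachable M w C \<longrightarrow>
        real (work_head C + 1) \<le> real c * max 1 (log 2 (real (length w))))"

definition logspace_computable :: "'x set \<Rightarrow> 'y set \<Rightarrow> ('x list \<Rightarrow> 'y list) \<Rightarrow> bool" where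
  "logspace_computable X Y f \<longleftrightarrow>
     (\<exists>M. is_transducer X Y M \<and> logspace_bounded X M \<and>
        (\<forall>w \<in> lists X. halts_with_output M w (f w)))"


section \<open>Normal forms in groups\<close>

text \<open>The letters of a word are themselves elements of the group.\<close>

definition word_val :: "('a, 'b) monoid_scheme \<Rightarrow> 'a list \<Rightarrow> 'a" where
  "word_val G w = foldr (\<otimes>\<^bsub>G\<^esub>) w \<one>\<^bsub>G\<^esub>"

definition finite_symmetric_generating_set :: "('a, 'b) monoid_scheme \<Rightarrow> 'a set \<Rightarrow> bool" where
  "finite_symmetric_generating_set G X \<longleftrightarrow>
     finite X \<and> X \<subseteq> carrier G \<and> (\<forall>x \<in> X. inv\<^bsub>G\<^esub> x \<in> X) \<and> generate G X = carrier G"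

definition finitely_generated :: "('a, 'b) monoid_scheme \<Rightarrow> bool" where
  "finitely_generated G \<longleftrightarrow> (\<exists>S. finite S \<and> S \<subseteq> carrier G \<and> generate G S = carrier G)"

definition normal_form :: "('a, 'b) monoid_scheme \<Rightarrow> 'a set \<Rightarrow> 'a list set \<Rightarrow> bool" where
  "normal_form G X L \<longleftrightarrow> L \<subseteq> lists X \<and> bij_betw (word_val G) L (carrier G)"

definition logspace_normal_form_function_onto ::
    "('a, 'b) monoid_scheme \<Rightarrow> 'a set \<Rightarrow> 'a list set \<Rightarrow> ('a list \<Rightarrow> 'a list) \<Rightarrow> bool" where
  "logspace_normal_form_function_onto G X L f \<longleftrightarrow>
     logspace_computable X X f \<and> normal_form G X L \<and>
     (\<forall>w \<in> lists X. f w \<in> L \<and> word_val G (f w) = word_val G w)"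

definition logspace_normal_form_function ::
    "('a, 'b) monoid_scheme \<Rightarrow> 'a set \<Rightarrow> ('a list \<Rightarrow> 'a list) \<Rightarrow> bool" where
  "logspace_normal_form_function G X f \<longleftrightarrow> (\<exists>L. logspace_normal_form_function_onto G X L f)"

definition has_logspace_normal_form_function :: "('a, 'b) monoid_scheme \<Rightarrow> bool" where
  "has_logspace_normal_form_function G \<longleftrightarrow>
     (\<exists>X f. finite_symmetric_generating_set G X \<and> logspace_normal_form_function G X f)"


section \<open>Free generators of \<open>\<int>\<^sup>n\<close>\<close>

definition free_abelian_generators ::
    "('a, 'b) monoid_scheme \<Rightarrow> nat \<Rightarrow> (nat \<Rightarrow> 'a) \<Rightarrow> bool" where
  "free_abelian_generators G n t \<longleftrightarrow>
     t ` {1..n} \<subseteq> carrier G \<and> generate G (t ` {1..n}) = carrier G \<and>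
     (\<forall>\<alpha> :: nat \<Rightarrow> int. finprod G (\<lambda>i. t i [^]\<^bsub>G\<^esub> \<alpha> i) {1..n} = \<one>\<^bsub>G\<^esub> \<longrightarrow>
        (\<forall>i \<in> {1..n}. \<alpha> i = 0))"

definition symmetric_letters :: "('a, 'b) monoid_scheme \<Rightarrow> nat \<Rightarrow> (nat \<Rightarrow> 'a) \<Rightarrow> 'a set" where
  "symmetric_letters G n t = t ` {1..n} \<union> (\<lambda>i. inv\<^bsub>G\<^esub> (t i)) ` {1..n}"

definition power_word :: "('a, 'b) monoid_scheme \<Rightarrow> 'a \<Rightarrow> int \<Rightarrow> 'a list" where
  "power_word G x k =
     (if k \<ge> 0 then replicate (nat k) x else replicate (nat (- k)) (inv\<^bsub>G\<^esub> x))"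

text \<open>The words \<open>t\<^sub>1\<^bsup>\<alpha>\<^sub>1\<^esup> \<dots> t\<^sub>n\<^bsup>\<alpha>\<^sub>n\<^esup>\<close>.\<close>

definition ordered_power_words ::
    "('a, 'b) monoid_scheme \<Rightarrow> nat \<Rightarrow> (nat \<Rightarrow> 'a) \<Rightarrow> 'a list set" where
  "ordered_power_words G n t =
     {concat (map (\<lambda>i. power_word G (t i) (\<alpha> i)) [1..<n + 1]) | \<alpha> :: nat \<Rightarrow> int. True}"

end

theory Submission
  imports Defs "HOL-Library.Countable"
begin

text \<open>
  A finitely generated abelian group contains a free abelian subgroup of finite index: a maximal
  independent subset \<open>t\<^sub>1, \<dots>, t\<^sub>n\<close> of a finite generating set generates one,
  because by maximality some positive power of every generator lies in the subgroup
  (\<open>power_in_range_power_prod_if_dependent\<close>, \<open>finite_representatives\<close>). So, for a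
  finite transversal \<open>T\<close> of the subgroup, every element is uniquely of the form
  \<open>t\<^sub>1\<^bsup>\<alpha>\<^sub>1\<^esup> \<dots> t\<^sub>n\<^bsup>\<alpha>\<^sub>n\<^esup> h\<close> with
  \<open>h \<in> T\<close>. This is the normal form. If the \<open>t\<^sub>i\<close> freely generate the whole
  group, then \<open>T = {\<one>}\<close>.

  The normal form of a word is read off a finite automaton with integer weights. Its states are
  the elements of \<open>T\<close>. In state \<open>h\<close>, the letter \<open>x\<close> leads to the state
  \<open>h'\<close> with \<open>h x = a h'\<close>, where \<open>a\<close> is a product of powers of the
  \<open>t\<^sub>i\<close>, and the exponent of \<open>t\<^sub>i\<close> in \<open>a\<close> is the \<open>i\<close>th weight of
  this transition. Since the group is abelian, \<open>\<alpha>\<^sub>i\<close> is the sum of the \<open>i\<close>th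
  weights along the word, and \<open>h\<close> is the last state
  (\<open>logspace_normal_form_free_by_finite\<close>).

  Such sums are computed in logarithmic space. They are linear in the length of the word, so a
  single counter, kept in binary on the work tape, can accumulate one of them while the input is
  read, and can then be counted down while the corresponding power is written; the next pass over
  the input deals with the next exponent. The construction of the transducer is split accordingly:
  \<open>logspace_computable_if_counter_program\<close> replaces the work tape by an abstract counter,
  and \<open>logspace_computable_weight_word\<close> programs the passes for an arbitrary weighted
  automaton.
\<close>

section \<open>Counter programs\<close>

text \<open>
  The intermediate machine model: a finite control with the input head and the output tape of a
  transducer, but with one natural number as its only memory. The zero test is part of the
  decrement instruction, because a binary counter notices that it is zero while it looks for a
  digit to borrow from.
\<close>

datatype ('q, 'y) instr = Halt | Incr 'q | Decr 'q 'q | Act move "'y list" 'q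

type_synonym ('q, 'x, 'y) counter_program = "'q \<Rightarrow> 'x cell \<Rightarrow> ('q, 'y) instr"

fun counter_step ::
    "('q, 'x, 'y) counter_program \<Rightarrow> 'x list \<Rightarrow> 'q \<times> nat \<times> nat \<times> 'y list \<Rightarrow> ('q \<times> nat \<times> nat \<times> 'y list) option"
where
  "counter_step P w (q, i, c, v) =
     (case P q (input_cell w i) of
        Halt \<Rightarrow> None
      | Incr r \<Rightarrow> Some (r, i, c + 1, v)
      | Decr r r' \<Rightarrow> Some (if c = 0 then (r, i, c, v) else (r', i, c - 1, v))
      | Act d u r \<Rightarrow> Some (r, move_input w d i, c, v @ u))"

text \<open>
  The bound \<open>K\<close> is tested after each step only, so it says nothing about the configuration
  in which a run starts. It is what limits the number of binary digits, hence the work space.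
\<close>

definition counter_run ::
    "('q, 'x, 'y) counter_program \<Rightarrow> 'x list \<Rightarrow> nat \<Rightarrow>
     'q \<times> nat \<times> nat \<times> 'y list \<Rightarrow> 'q \<times> nat \<times> nat \<times> 'y list \<Rightarrow> bool"
where
  "counter_run P w K =
     (\<lambda>C D. counter_step P w C = Some D \<and> fst (snd (snd D)) \<le> K)\<^sup>*\<^sup>*"

text \<open>
  The instance of the induction rule for quadruples, which lets the cases name the components of a
  configuration.
\<close>

lemmas rtranclp_induct4 =
  rtranclp_induct[of _ "(a1, a2, a3, a4)" "(b1, b2, b3, b4)", split_rule,
    consumes 1, case_names refl step]

definition cells :: "'x set \<Rightarrow> 'x cell set" where
  "cells X = {Left_End, Right_End} \<union> Letter ` X"

definition is_counter_program ::
    "'x set \<Rightarrow> 'y set \<Rightarrow> 'q set \<Rightarrow> ('q, 'x, 'y) counter_program \<Rightarrow> bool"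
where
  "is_counter_program X Y Q P \<longleftrightarrow> finite Q \<and>
     (\<exists>b. \<forall>q \<in> Q. \<forall>a \<in> cells X.
        case P q a of
          Halt \<Rightarrow> True
        | Incr r \<Rightarrow> r \<in> Q
        | Decr r r' \<Rightarrow> r \<in> Q \<and> r' \<in> Q
        | Act d u r \<Rightarrow> r \<in> Q \<and> u \<in> lists Y \<and> length u \<le> b)"

section \<open>Binary counters\<close>

text \<open>
  Numerals list the least significant digit first, as on the tape. Leading zeros are permitted, so
  that a decrement need not shorten the numeral.
\<close>

fun bin_val :: "bool list \<Rightarrow> nat" where
  "bin_val [] = 0"
| "bin_val (b # bs) = of_bool b + 2 * bin_val bs"

fun bin_inc :: "bool list \<Rightarrow> bool list" where
  "bin_inc [] = [True]"
| "bin_inc (False # bs) = True # bs"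
| "bin_inc (True # bs) = False # bin_inc bs"

fun bin_dec :: "bool list \<Rightarrow> bool list" where
  "bin_dec [] = []"
| "bin_dec (True # bs) = False # bs"
| "bin_dec (False # bs) = True # bin_dec bs"

lemma bin_val_inc: "bin_val (bin_inc bs) = bin_val bs + 1"
  by (induction bs rule: bin_inc.induct) auto

lemma bin_val_dec: "bin_val bs \<noteq> 0 \<Longrightarrow> bin_val (bin_dec bs) = bin_val bs - 1"
  by (induction bs rule: bin_dec.induct) auto

lemma length_bin_dec: "length (bin_dec bs) = length bs"
  by (induction bs rule: bin_dec.induct) auto

text \<open>
  A numeral with the full length \<open>l\<close> grows only if all its digits are ones, and then its
  value is already \<open>2 ^ l - 1\<close>.
\<close>

lemma length_bin_inc:
  "length bs \<le> l \<Longrightarrow> bin_val bs + 1 < 2 ^ l \<Longrightarrow> length (bin_inc bs) \<le> l"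
proof (induction bs arbitrary: l rule: bin_inc.induct)
  case 1
  then show ?case by (cases l) auto
next
  case (3 bs)
  then obtain k where "l = Suc k" by (cases l) auto
  with 3 show ?case by simp
qed auto

lemma bin_val_zero: "bin_val bs = 0 \<Longrightarrow> bs = replicate (length bs) False"
  by (induction bs) (auto split: if_splits)

section \<open>Simulation of counter programs by logspace transducers\<close>

text \<open>
  In a state \<open>Run q\<close> the work head is on square \<open>0\<close> and the next instruction of
  the program is about to be executed. The other states perform the carry, the borrow, and the way
  back to square \<open>0\<close>. \<open>Clear\<close> is the way back after a borrow from zero: it restores
  the zeros that the search for a one has overwritten.
\<close>

datatype 'q control = Run 'q | Add_One 'q | Sub_One 'q 'q | Return 'q | Clear 'q

instance control :: (countable) countable
  by countable_datatype

text \<open>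
  The binary digits zero and one are represented by the work symbols \<open>1\<close> and
  \<open>2\<close>, while \<open>0\<close> is the blank. Square \<open>0\<close> stays blank forever: as a left
  move on it has no effect, a blank there is how the machine recognises the left end of the tape.
  The numeral occupies the squares from \<open>1\<close> on and ends before the next blank.
\<close>

fun control_step ::
    "('q, 'x, 'y) counter_program \<Rightarrow> 'q control \<Rightarrow> 'x cell \<Rightarrow> nat \<Rightarrow>
     ('q control \<times> nat \<times> move \<times> move \<times> 'y list) option"
where
  "control_step P (Run q) a s =
     (case P q a of
        Halt \<Rightarrow> None
      | Incr r \<Rightarrow> Some (Add_One r, s, Stay, Right, [])
      | Decr r r' \<Rightarrow> Some (Sub_One r r', s, Stay, Right, [])
      | Act d u r \<Rightarrow> Some (Run r, s, d, Stay, u))"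
| "control_step P (Add_One r) a s =
     (if s = 2 then Some (Add_One r, 1, Stay, Right, []) else Some (Return r, 2, Stay, Left, []))"
| "control_step P (Sub_One r r') a s =
     (if s = 1 then Some (Sub_One r r', 2, Stay, Right, [])
      else if s = 2 then Some (Return r', 1, Stay, Left, [])
      else Some (Clear r, s, Stay, Left, []))"
| "control_step P (Return r) a s =
     (if s = 0 then Some (Run r, s, Stay, Stay, []) else Some (Return r, s, Stay, Left, []))"
| "control_step P (Clear r) a s =
     (if s = 0 then Some (Run r, s, Stay, Stay, []) else Some (Clear r, 1, Stay, Left, []))"

definition controls :: "'q set \<Rightarrow> 'q control set" where
  "controls Q = Run ` Q \<union> Add_One ` Q \<union> case_prod Sub_One ` (Q \<times> Q) \<union> Return ` Q \<union> Clear ` Q"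

definition counter_transducer ::
    "'q::countable set \<Rightarrow> 'q \<Rightarrow> ('q, 'x, 'y) counter_program \<Rightarrow> ('x, 'y) transducer"
where
  "counter_transducer Q q P =
     \<lparr>states = to_nat ` controls Q, initial = to_nat (Run q), work_symbols = {0, 1, 2}, blank = 0,
      transition = (\<lambda>n a s. map_option (map_prod to_nat id) (control_step P (from_nat n) a s))\<rparr>"

lemma is_transducer_counter_transducer:
  assumes P: "is_counter_program X Y Q P" and q: "q \<in> Q"
  shows "is_transducer X Y (counter_transducer Q q P)"
proof -
  obtain b where b: "\<And>q a. q \<in> Q \<Longrightarrow> a \<in> cells X \<Longrightarrow>
        (case P q a of Halt \<Rightarrow> True | Incr r \<Rightarrow> r \<in> Q | Decr r r' \<Rightarrow> r \<in> Q \<and> r' \<in> Q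
         | Act d u r \<Rightarrow> r \<in> Q \<and> u \<in> lists Y \<and> length u \<le> b)"
    and fin: "finite Q"
    using P unfolding is_counter_program_def by blast
  have step: "c' \<in> controls Q \<and> s' \<in> {0, 1, 2} \<and> u \<in> lists Y \<and> length u \<le> b"
    if "c \<in> controls Q" "a \<in> cells X" "s \<in> {0, 1, 2}"
      "control_step P c a s = Some (c', s', d, e, u)" for c a s c' s' d e u
  proof (cases c)
    case (Run r)
    then have "r \<in> Q" using that(1) by (auto simp: controls_def)
    from b[OF this that(2)] show ?thesis
      using that Run by (auto simp: controls_def split: instr.splits)
  qed (use that in \<open>auto simp: controls_def split: if_splits\<close>)
  have "finite (controls Q)"
    using fin by (simp add: controls_def)
  moreover have "Run q \<in> controls Q"
    using q by (simp add: controls_def)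
  moreover have "\<forall>n \<in> to_nat ` controls Q. \<forall>a \<in> {Left_End, Right_End} \<union> Letter ` X. \<forall>s \<in> {0, 1, 2}.
      \<forall>n' s' d e u. map_option (map_prod to_nat id) (control_step P (from_nat n) a s)
          = Some (n', s', d, e, u) \<longrightarrow>
        n' \<in> to_nat ` controls Q \<and> s' \<in> {0, 1, 2} \<and> u \<in> lists Y \<and> length u \<le> b"
    unfolding cells_def[symmetric]
  proof (intro ballI allI impI)
    fix n a s n' s' d e u
    assume n: "n \<in> to_nat ` controls Q" and a: "a \<in> cells X" and s: "s \<in> {0, 1, 2::nat}"
      and eq: "map_option (map_prod to_nat id) (control_step P (from_nat n) a s) = Some (n', s', d, e, u)"
    from n obtain c where c: "c \<in> controls Q" "n = to_nat c" by blast
    from eq obtain c' where c': "control_step P c a s = Some (c', s', d, e, u)" "n' = to_nat c'"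
      using c(2) by (auto simp: map_prod_def split: prod.splits)
    show "n' \<in> to_nat ` controls Q \<and> s' \<in> {0, 1, 2} \<and> u \<in> lists Y \<and> length u \<le> b"
      using step[OF c(1) a s c'(1)] c'(2) by blast
  qed
  ultimately show ?thesis
    using fin unfolding is_transducer_def counter_transducer_def transducer.select_convs
    by (intro conjI exI[of _ b]) (assumption | simp)+
qed

text \<open>
  Only the source of a step is bounded; the halting configuration that ends a run is
  checked separately.
\<close>

definition bounded_step ::
    "('x, 'y) transducer \<Rightarrow> 'x list \<Rightarrow> nat \<Rightarrow> 'y config \<Rightarrow> 'y config \<Rightarrow> bool"
where
  "bounded_step M w B C D \<longleftrightarrow> step M w C D \<and> work_head C \<le> B"

lemma step_deterministic: "step M w C D \<Longrightarrow> step M w C D' \<Longrightarrow> D = D'"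
  by (auto simp: step.simps)

text \<open>
  Since steps are deterministic, every reachable configuration lies on the run that halts. So a
  space bound along this one run is a space bound for all reachable configurations.
\<close>

lemma bounded_if_halting_run_bounded:
  assumes "(bounded_step M w B)\<^sup>*\<^sup>* C D" and "current_transition M w D = None" and "work_head D \<le> B"
    and "(step M w)\<^sup>*\<^sup>* C E"
  shows "work_head E \<le> B"
  using assms
proof (induction rule: converse_rtranclp_induct)
  case base
  then have "\<not> step M w D E'" for E'
    by (auto simp: step.simps)
  with base have "E = D"
    by (metis converse_rtranclpE)
  with base show ?case by simp
next
  case (step C C')
  show ?case
  proof (cases "E = C")
    case True
    then show ?thesis using step by (simp add: bounded_step_def)
  next
    case False
    with step.prems(3) obtain C'' where "step M w C C''" "(step M w)\<^sup>*\<^sup>* C'' E"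
      by (metis converse_rtranclpE)
    then have "(step M w)\<^sup>*\<^sup>* C' E"
      using step_deterministic step.hyps(1) by (metis bounded_step_def)
    then show ?thesis
      using step.IH step.prems by blast
  qed
qed

definition tape :: "bool list \<Rightarrow> nat \<Rightarrow> nat" where
  "tape bs p = (if p = 0 \<or> p > length bs then 0 else if bs ! (p - 1) then 2 else 1)"

lemma tape_0 [simp]: "tape bs 0 = 0"
  and tape_end [simp]: "tape bs (Suc (length bs)) = 0"
  and tape_mid [simp]: "tape (as @ b # bs) (Suc (length as)) = (if b then 2 else 1)"
  by (auto simp: tape_def)

lemma tape_upd_0 [simp]: "(tape bs)(0 := 0) = tape bs"
  by (simp add: fun_upd_idem)

lemma tape_append [simp]: "(tape as)(Suc (length as) := 2) = tape (as @ [True])"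
  by (auto simp: tape_def fun_eq_iff nth_append nth_Cons')

lemma tape_upd [simp]:
  "(tape (as @ b # bs))(Suc (length as) := Suc 0) = tape (as @ False # bs)"
  "(tape (as @ b # bs))(Suc (length as) := 2) = tape (as @ True # bs)"
  by (auto simp: tape_def fun_eq_iff nth_append nth_Cons')

context
  fixes P :: "('q::countable, 'x, 'y) counter_program" and Q :: "'q set" and q0 :: 'q
    and w :: "'x list" and B :: nat
begin

abbreviation "machine \<equiv> counter_transducer Q q0 P"

definition control_config :: "'q control \<Rightarrow> nat \<Rightarrow> (nat \<Rightarrow> nat) \<Rightarrow> nat \<Rightarrow> 'y list \<Rightarrow> 'y config" where
  "control_config c i T h v =
     \<lparr>state = to_nat c, input_head = i, work_tape = T, work_head = h, written = v\<rparr>"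

abbreviation bounded_run :: "'y config \<Rightarrow> 'y config \<Rightarrow> bool" where
  "bounded_run \<equiv> (bounded_step machine w B)\<^sup>*\<^sup>*"

text \<open>
  One symbolic step of the transducer, in the form of a rule that extends a run at its beginning; the
  components of the new configuration are computed by simplification.
\<close>

lemma run_control_step:
  assumes "control_step P c (input_cell w i) (T h) = Some (c', s, d, e, u)" and "h \<le> B"
    and "bounded_run (control_config c' (move_input w d i) (T(h := s)) (move_work e h) (v @ u)) D"
  shows "bounded_run (control_config c i T h v) D"
proof -
  have "current_transition machine w (control_config c i T h v) = Some (to_nat c', s, d, e, u)"
    using assms(1) by (simp add: current_transition_def control_config_def counter_transducer_def)
  from step.intros[OF this]
  have "bounded_step machine w B (control_config c i T h v)
      (control_config c' (move_input w d i) (T(h := s)) (move_work e h) (v @ u))"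
    using assms(2) by (simp add: bounded_step_def control_config_def)
  then show ?thesis
    using assms(3) by (rule converse_rtranclp_into_rtranclp)
qed

lemma run_Return:
  "h \<le> length bs \<Longrightarrow> h \<le> B \<Longrightarrow> bounded_run (control_config (Return r) i (tape bs) h v) (control_config (Run r) i (tape bs) 0 v)"
proof (induction h)
  case 0
  then show ?case
    by (intro run_control_step[of "Return r"]) auto
next
  case (Suc h)
  then have "tape bs (Suc h) \<noteq> 0"
    by (simp add: tape_def)
  then show ?case
    using Suc by (intro run_control_step[of "Return r"]) auto
qed

lemma run_Clear:
  "h \<le> B \<Longrightarrow> bounded_run (control_config (Clear r) i (tape (replicate h True @ bs)) h v)
     (control_config (Run r) i (tape (replicate h False @ bs)) 0 v)"
proof (induction h arbitrary: bs)
  case 0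
  then show ?case
    by (intro run_control_step[of "Clear r"]) auto
next
  case (Suc h)
  have eq: "replicate (Suc h) b @ bs = replicate h b @ b # bs" for b
    by (simp add: replicate_app_Cons_same)
  have "tape (replicate h True @ True # bs) (Suc h) = 2"
    and "(tape (replicate h True @ True # bs)) (Suc h := Suc 0) = tape (replicate h True @ False # bs)"
    using tape_mid[of "replicate h True"] tape_upd[of "replicate h True"] by simp_all
  then show ?case
    using Suc unfolding eq by (intro run_control_step[of "Clear r"]) auto
qed

text \<open>
  The digits \<open>as\<close> are those that the work head has already passed and rewritten; the
  carry still has to be added to \<open>bs\<close>.
\<close>

lemma run_Add_One:
  "length as + length bs + 1 \<le> B \<Longrightarrow>
   bounded_run (control_config (Add_One r) i (tape (as @ bs)) (Suc (length as)) v)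
     (control_config (Run r) i (tape (as @ bin_inc bs)) 0 v)"
proof (induction bs arbitrary: as rule: bin_inc.induct)
  case (3 bs)
  have "bounded_run (control_config (Add_One r) i (tape ((as @ [False]) @ bs)) (Suc (length (as @ [False]))) v)
     (control_config (Run r) i (tape ((as @ [False]) @ bin_inc bs)) 0 v)"
    using 3 by (intro 3) auto
  then show ?case
    using 3 by (intro run_control_step[of "Add_One r"]) auto
next
  case 1
  then show ?case
    using run_Return[of "length as" "as @ [True]" r i v]
    by (intro run_control_step[of "Add_One r"]) auto
next
  case (2 bs)
  then show ?case
    using run_Return[of "length as" "as @ True # bs" r i v]
    by (intro run_control_step[of "Add_One r"]) auto
qed

lemma run_Sub_One:
  "length as + length bs + 1 \<le> B \<Longrightarrow> bin_val bs \<noteq> 0 \<Longrightarrow>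
   bounded_run (control_config (Sub_One r r') i (tape (as @ bs)) (Suc (length as)) v)
     (control_config (Run r') i (tape (as @ bin_dec bs)) 0 v)"
proof (induction bs arbitrary: as rule: bin_dec.induct)
  case (3 bs)
  have "bounded_run (control_config (Sub_One r r') i (tape ((as @ [True]) @ bs)) (Suc (length (as @ [True]))) v)
     (control_config (Run r') i (tape ((as @ [True]) @ bin_dec bs)) 0 v)"
    using 3 by (intro 3) auto
  then show ?case
    using 3 by (intro run_control_step[of "Sub_One r r'"]) auto
next
  case (2 bs)
  then show ?case
    using run_Return[of "length as" "as @ False # bs" r' i v]
    by (intro run_control_step[of "Sub_One r r'"]) auto
qed simp

text \<open>
  On zero, the search for a one turns all \<open>l\<close> passed zeros into ones until it meets the
  blank; \<open>Clear\<close> undoes this.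
\<close>

lemma run_Sub_One_zero:
  "l + m + 1 \<le> B \<Longrightarrow>
   bounded_run (control_config (Sub_One r r') i (tape (replicate l True @ replicate m False)) (Suc l) v)
     (control_config (Run r) i (tape (replicate (l + m) False)) 0 v)"
proof (induction m arbitrary: l)
  case 0
  have "tape (replicate l True) (Suc l) = 0"
    using tape_end[of "replicate l True"] by simp
  then show ?case
    using 0 run_Clear[of l r i "[]" v]
    by (intro run_control_step[of "Sub_One r r'"]) (auto simp: fun_upd_idem)
next
  case (Suc m)
  have eq: "replicate (Suc l) True @ bs = replicate l True @ True # bs" for bs
    by (simp add: replicate_app_Cons_same)
  have "tape (replicate l True @ False # replicate m False) (Suc l) = 1"
    and "(tape (replicate l True @ False # replicate m False)) (Suc l := 2)
      = tape (replicate l True @ True # replicate m False)"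
    using tape_mid[of "replicate l True" False] tape_upd[of "replicate l True" False] by simp_all
  then show ?case
    using Suc(1)[of "Suc l", unfolded eq] Suc(2)
    by (intro run_control_step[of "Sub_One r r'"]) auto
qed

lemma run_counter_step:
  assumes step: "counter_step P w (q, i, bin_val bs, v) = Some (q', i', c', v')"
    and len: "length bs \<le> l" and c': "c' < 2 ^ l" and B: "l < B"
  shows "\<exists>bs'. bin_val bs' = c' \<and> length bs' \<le> l \<and>
    bounded_run (control_config (Run q) i (tape bs) 0 v) (control_config (Run q') i' (tape bs') 0 v')"
proof (cases "P q (input_cell w i)")
  case Halt
  then show ?thesis using step by simp
next
  case (Incr r)
  then have "bounded_run (control_config (Run q) i (tape bs) 0 v) (control_config (Run r) i (tape (bin_inc bs)) 0 v)"
    using run_Add_One[of "[]" bs r i v] len B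
    by (intro run_control_step[of "Run q"]) (auto simp: fun_upd_idem)
  then show ?thesis
    using step Incr length_bin_inc[OF len] c' bin_val_inc[of bs] by auto
next
  case (Decr r r')
  show ?thesis
  proof (cases "bin_val bs = 0")
    case True
    then obtain m where bs: "bs = replicate m False"
      using bin_val_zero by blast
    have "bounded_run (control_config (Run q) i (tape bs) 0 v) (control_config (Run r) i (tape bs) 0 v)"
      using run_Sub_One_zero[of 0 m r r' i v] len B Decr bs
      by (intro run_control_step[of "Run q"]) (auto simp: fun_upd_idem)
    then show ?thesis
      using True step Decr len by auto
  next
    case False
    have "bounded_run (control_config (Run q) i (tape bs) 0 v) (control_config (Run r') i (tape (bin_dec bs)) 0 v)"
      using run_Sub_One[of "[]" bs r r' i v] len B Decr False
      by (intro run_control_step[of "Run q"]) (auto simp: fun_upd_idem)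
    then show ?thesis
      using False step Decr len bin_val_dec[OF False] length_bin_dec[of bs] by auto
  qed
next
  case (Act d u r)
  then have "bounded_run (control_config (Run q) i (tape bs) 0 v)
      (control_config (Run r) (move_input w d i) (tape bs) 0 (v @ u))"
    by (intro run_control_step[of "Run q"]) (auto simp: fun_upd_idem)
  then show ?thesis
    using step Act len by auto
qed

text \<open>
  The simulation. Numerals of length \<open>l\<close> hold all counter values up to \<open>K\<close>, and
  the head visits at most the blank square \<open>l + 1\<close> behind such a numeral, which
  \<open>l < B\<close> allows.
\<close>

lemma run_counter_run:
  assumes "counter_run P w K (q, i, c, v) (q', i', c', v')"
    and "bin_val bs = c" and "length bs \<le> l" and "K < 2 ^ l" and "l < B"
  shows "\<exists>bs'. bin_val bs' = c' \<and> length bs' \<le> l \<and>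
    bounded_run (control_config (Run q) i (tape bs) 0 v) (control_config (Run q') i' (tape bs') 0 v')"
  using assms(1) unfolding counter_run_def
proof (induction rule: rtranclp_induct4)
  case refl
  then show ?case using assms by auto
next
  case (step q1 i1 c1 v1 q2 i2 c2 v2)
  then obtain bs1 where bs1: "bin_val bs1 = c1" "length bs1 \<le> l"
      "bounded_run (control_config (Run q) i (tape bs) 0 v) (control_config (Run q1) i1 (tape bs1) 0 v1)"
    by blast
  have "counter_step P w (q1, i1, bin_val bs1, v1) = Some (q2, i2, c2, v2)" "c2 < 2 ^ l"
    using step(2) bs1(1) assms(4) by auto
  from run_counter_step[OF this(1) bs1(2) this(2) assms(5)]
  obtain bs2 where "bin_val bs2 = c2" "length bs2 \<le> l"
      "bounded_run (control_config (Run q1) i1 (tape bs1) 0 v1) (control_config (Run q2) i2 (tape bs2) 0 v2)"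
    by blast
  with bs1(3) show ?case
    by (intro exI[of _ bs2]) (auto intro: rtranclp_trans)
qed

end

text \<open>
  A counter that is linear in \<open>n\<close> needs logarithmically many digits: with
  \<open>n < 2 ^ b\<close>, the trivial bound \<open>c < 2 ^ c\<close> shows that \<open>c + b\<close> digits suffice.
  The \<open>2\<close> added to \<open>l\<close> accounts for square \<open>0\<close> and for the blank behind the
  numeral.
\<close>

lemma log_space_estimate:
  fixes c n :: nat
  obtains l where "c * (n + 1) < 2 ^ l" and "real (l + 2) \<le> real (c + 4) * max 1 (log 2 (real n))"
proof -
  obtain b where b: "n < 2 ^ b" "real b \<le> 1 + max 1 (log 2 (real n))"
  proof (cases "n = 0")
    case True
    then show ?thesis using that[of 0] by auto
  next
    case False
    define b where "b = nat \<lfloor>log 2 (real n)\<rfloor> + 1"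
    have nn: "0 \<le> log 2 (real n)" using False by simp
    have "real b \<ge> log 2 (real n)" "real b \<le> 1 + log 2 (real n)" "log 2 (real n) < real b"
      using nn unfolding b_def by linarith+
    moreover from this have "real n < 2 powr real b"
      using False by (simp add: log_less_iff)
    then have "n < 2 ^ b"
      by (simp add: powr_realpow)
    ultimately show ?thesis using that[of b] by auto
  qed
  have "c < 2 ^ c" by (rule less_exp)
  moreover have "n + 1 \<le> 2 ^ b" using b(1) by simp
  ultimately have "c * (n + 1) < 2 ^ c * 2 ^ b"
    by (intro mult_less_le_imp_less) auto
  then have 1: "c * (n + 1) < 2 ^ (c + b)" by (simp add: power_add)
  define m where "m = max 1 (log 2 (real n))"
  have "m \<ge> 1" by (simp add: m_def)
  then have "real c \<le> real c * m" "3 \<le> 3 * m"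
    by (simp_all add: mult_le_cancel_left1)
  then have "real (c + b + 2) \<le> real (c + 4) * m"
    using b(2) by (simp add: m_def[symmetric] algebra_simps)
  with 1 show ?thesis
    using that unfolding m_def by blast
qed

text \<open>
  The interface to the machine model: from here on it suffices to program with one counter whose
  values are linear in the length of the input.
\<close>

theorem logspace_computable_if_counter_program:
  fixes P :: "('q::countable, 'x, 'y) counter_program"
  assumes P: "is_counter_program X Y Q P" and q: "q \<in> Q"
    and run: "\<And>w. w \<in> lists X \<Longrightarrow>
      \<exists>C. counter_run P w (c * (length w + 1)) (q, 0, 0, []) C \<and> counter_step P w C = None \<and>
        snd (snd (snd C)) = f w"
  shows "logspace_computable X Y f"
proof -
  define M where "M = counter_transducer Q q P"
  have *: "halts_with_output M w (f w) \<and> (\<forall>C. reachable M w C \<longrightarrow>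
      real (work_head C + 1) \<le> real (c + 4) * max 1 (log 2 (real (length w))))"
    if w: "w \<in> lists X" for w
  proof -
    obtain l where l: "c * (length w + 1) < 2 ^ l"
        "real (l + 2) \<le> real (c + 4) * max 1 (log 2 (real (length w)))"
      using log_space_estimate .
    obtain q' i' c' where C: "counter_run P w (c * (length w + 1)) (q, 0, 0, []) (q', i', c', f w)"
        "counter_step P w (q', i', c', f w) = None"
      using run[OF w] by auto
    obtain bs where bs: "(bounded_step M w (Suc l))\<^sup>*\<^sup>* (control_config (Run q) 0 (tape []) 0 [])
        (control_config (Run q') i' (tape bs) 0 (f w))"
      using run_counter_run[OF C(1), of "[]" l "Suc l" Q q] l(1) unfolding M_def by auto
    have init: "initial_config M = control_config (Run q) 0 (tape []) 0 []"
      by (simp add: M_def initial_config_def control_config_def counter_transducer_def tape_def fun_eq_iff)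
    have halt: "current_transition M w (control_config (Run q') i' (tape bs) 0 (f w)) = None"
      using C(2) by (auto simp: M_def current_transition_def control_config_def counter_transducer_def
          split: instr.splits)
    have "(step M w)\<^sup>*\<^sup>* (initial_config M) (control_config (Run q') i' (tape bs) 0 (f w))"
      unfolding init using bs
      by (rule rtranclp_mono[THEN predicate2D, rotated]) (auto simp: bounded_step_def)
    then have "halts_with_output M w (f w)"
      using halt unfolding halts_with_output_def reachable_def by (force simp: control_config_def)
    moreover have "work_head C \<le> Suc l" if "reachable M w C" for C
      using bounded_if_halting_run_bounded[OF bs halt] that
      unfolding reachable_def init by (simp add: control_config_def)
    then have "work_head C + 1 \<le> l + 2" if "reachable M w C" for C
      using that by fastforce
    then have "real (work_head C + 1) \<le> real (c + 4) * max 1 (log 2 (real (length w)))"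
      if "reachable M w C" for C
      using that l(2) by (meson add_le_mono1 of_nat_mono order_trans)
    ultimately show ?thesis by blast
  qed
  show ?thesis
    unfolding logspace_computable_def logspace_bounded_def
    using * is_transducer_counter_transducer[OF P q] unfolding M_def by blast
qed


section \<open>A program for weighted automata\<close>

text \<open>
  The word that a group reads as a power, with separate letters for the generator and its
  inverse.
\<close>

definition signed_power :: "'y \<Rightarrow> 'y \<Rightarrow> int \<Rightarrow> 'y list" where
  "signed_power p m z = (if 0 \<le> z then replicate (nat z) p else replicate (nat (- z)) m)"

fun run_weight :: "('h \<Rightarrow> 'x \<Rightarrow> 'h) \<Rightarrow> ('h \<Rightarrow> 'x \<Rightarrow> int) \<Rightarrow> 'h \<Rightarrow> 'x list \<Rightarrow> int" where
  "run_weight \<delta> \<omega> h [] = 0"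
| "run_weight \<delta> \<omega> h (x # w) = \<omega> h x + run_weight \<delta> \<omega> (\<delta> h x) w"

text \<open>
  The program passes over the input once for each weight function. The number is the index of the
  pass, and the boolean is the sign of the counter value, true meaning negative.
  \<open>Add j h s k\<close> is the state in which \<open>k\<close> still has to be added to the counter.
\<close>

datatype 'h phase =
  Read nat 'h bool | Add nat 'h bool int | Emit nat bool | Put nat bool | Rewind nat | Done

instance phase :: (countable) countable
  by countable_datatype

lemma counter_run_refl: "counter_run P w K C C"
  by (simp add: counter_run_def)

lemma counter_run_trans:
  "counter_run P w K C D \<Longrightarrow> counter_run P w K D E \<Longrightarrow> counter_run P w K C E"
  by (simp add: counter_run_def)

lemma counter_run_step:
  "counter_step P w C = Some D \<Longrightarrow> fst (snd (snd D)) \<le> K \<Longrightarrow> counter_run P w K D E \<Longrightarrow>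
    counter_run P w K C E"
  unfolding counter_run_def by (rule converse_rtranclp_into_rtranclp) auto

lemma input_cell_simps [simp]:
  "input_cell w 0 = Left_End"
  "input_cell w (Suc (length w)) = Right_End"
  "input_cell (us @ x # vs) (Suc (length us)) = Letter x"
  by (simp_all add: input_cell_def)

context
  fixes n :: nat and \<delta> :: "'h::countable \<Rightarrow> 'x \<Rightarrow> 'h" and \<omega> :: "nat \<Rightarrow> 'h \<Rightarrow> 'x \<Rightarrow> int"
    and h\<^sub>0 :: 'h and p m :: "nat \<Rightarrow> 'y" and \<rho> :: "'h \<Rightarrow> 'y list"
begin

text \<open>
  Pass \<open>j \<le> n\<close> computes the \<open>j\<close>th total weight in the counter, and then counts it
  down while writing one letter for each unit. Memory of the automaton state does not survive
  the way back to the left end, so one more pass, number \<open>n + 1\<close>, recomputes the final state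
  and writes its word; the counter value of that pass is discarded.
\<close>

fun weight_program :: "('h phase, 'x, 'y) counter_program" where
  "weight_program (Read j h s) Left_End = Act Right [] (Read j h s)"
| "weight_program (Read j h s) (Letter x) = Act Right [] (Add j (\<delta> h x) s (\<omega> j h x))"
| "weight_program (Read j h s) Right_End =
     (if j \<le> n then Act Stay [] (Emit j s) else Act Stay (\<rho> h) Done)"
| "weight_program (Add j h s k) a =
     (if k = 0 then Act Stay [] (Read j h s)
      else if (k < 0) = s then Incr (Add j h s (k - sgn k))
      else Decr (Add j h (\<not> s) k) (Add j h s (k - sgn k)))"
| "weight_program (Emit j s) a = Decr (Rewind (j + 1)) (Put j s)"
| "weight_program (Put j s) a = Act Stay [if s then m j else p j] (Emit j s)"
| "weight_program (Rewind j) a =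
     (if a = Left_End then Act Stay [] (Read j h\<^sub>0 False) else Act Left [] (Rewind j))"
| "weight_program Done a = Halt"

definition signed_value :: "bool \<Rightarrow> nat \<Rightarrow> int" where
  "signed_value s c = (if s then - int c else int c)"

lemma signed_value_False_0 [simp]: "signed_value False 0 = 0"
  by (simp add: signed_value_def)

lemma abs_signed_value: "\<bar>signed_value s c\<bar> = int c"
  by (simp add: signed_value_def)

text \<open>
  Along the way the counter value moves monotonically from \<open>signed_value s c\<close> to
  \<open>signed_value s c + k\<close>, so a bound for both ends is a bound for the whole loop. When the
  counter reaches zero with the wrong sign, only the sign changes, and after that the counter
  grows.
\<close>

lemma counter_run_Add:
  assumes "\<bar>signed_value s c\<bar> \<le> int K" and "\<bar>signed_value s c + k\<bar> \<le> int K"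
  shows "\<exists>s' c'. signed_value s' c' = signed_value s c + k \<and>
    counter_run weight_program w K (Add j h s k, i, c, v) (Read j h s', i, c', v)"
  using assms
proof (induction "nat \<bar>k\<bar>" arbitrary: s c k)
  case 0
  then have "k = 0" "c \<le> K" by (auto simp: signed_value_def split: if_splits)
  then show ?case
    by (intro exI[of _ s] exI[of _ c]) (auto intro!: counter_run_step[OF _ _ counter_run_refl])
next
  case (Suc l)
  then have k: "k \<noteq> 0" "l = nat \<bar>k - sgn k\<bar>" and c: "c \<le> K"
    by (auto simp: signed_value_def sgn_if split: if_splits)
  note IH = Suc.hyps(1)[OF k(2)]
  \<comment> \<open>The sign of the counter agrees with that of \<open>k\<close>, so the absolute value increases.\<close>
  have grow: "\<exists>s' c'. signed_value s' c' = signed_value s c + k \<and>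
      counter_run weight_program w K (Add j h s k, i, c, v) (Read j h s', i, c', v)"
    if s: "(k < 0) = s" and c: "int c + \<bar>k\<bar> \<le> int K" for s c
  proof -
    have "signed_value s (c + 1) = signed_value s c + sgn k" using s k by (auto simp: signed_value_def sgn_if)
    moreover have "\<bar>signed_value s (c + 1)\<bar> \<le> int K" "\<bar>signed_value s (c + 1) + (k - sgn k)\<bar> \<le> int K" "c + 1 \<le> K"
      using s c k by (auto simp: signed_value_def sgn_if)
    ultimately obtain s' c' where *: "signed_value s' c' = signed_value s c + k"
      "counter_run weight_program w K (Add j h s (k - sgn k), i, c + 1, v) (Read j h s', i, c', v)"
      using IH[of s "c + 1"] by auto
    have "counter_run weight_program w K (Add j h s k, i, c, v) (Read j h s', i, c', v)"
      using s k \<open>c + 1 \<le> K\<close> by (intro counter_run_step[OF _ _ *(2)]) auto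
    then show ?thesis
      using *(1) by blast
  qed
  consider "(k < 0) = s" | "(k < 0) \<noteq> s" "c = 0" | "(k < 0) \<noteq> s" "c \<noteq> 0" by blast
  then show ?case
  proof cases
    case 1
    then have "int c + \<bar>k\<bar> \<le> int K"
      using Suc.prems by (auto simp: signed_value_def split: if_splits)
    with 1 show ?thesis
      by (rule grow)
  next
    \<comment> \<open>Zero has two representations; the program switches to the one with the sign of \<open>k\<close>.\<close>
    case 2
    have "(k < 0) = (\<not> s)" "int 0 + \<bar>k\<bar> \<le> int K"
      using Suc.prems 2 by (auto simp: signed_value_def split: if_splits)
    from grow[OF this] obtain s' c' where *: "signed_value s' c' = signed_value (\<not> s) 0 + k"
      "counter_run weight_program w K (Add j h (\<not> s) k, i, 0, v) (Read j h s', i, c', v)"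
      by blast
    have "counter_run weight_program w K (Add j h s k, i, c, v) (Read j h s', i, c', v)"
      using 2 k by (intro counter_run_step[OF _ _ *(2)]) auto
    moreover have "signed_value s' c' = signed_value s c + k"
      using *(1) 2 by (simp add: signed_value_def)
    ultimately show ?thesis by blast
  next
    case 3
    have "signed_value s (c - 1) = signed_value s c + sgn k"
      using 3 k by (auto simp: signed_value_def sgn_if)
    moreover have "\<bar>signed_value s (c - 1)\<bar> \<le> int K" "\<bar>signed_value s (c - 1) + (k - sgn k)\<bar> \<le> int K"
      using 3 k Suc.prems by (auto simp: signed_value_def sgn_if split: if_splits)
    ultimately obtain s' c' where *: "signed_value s' c' = signed_value s c + k"
      "counter_run weight_program w K (Add j h s (k - sgn k), i, c - 1, v) (Read j h s', i, c', v)"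
      using IH[of s "c - 1"] by auto
    have "counter_run weight_program w K (Add j h s k, i, c, v) (Read j h s', i, c', v)"
      using 3 k c by (intro counter_run_step[OF _ _ *(2)]) auto
    with *(1) show ?thesis by blast
  qed
qed

text \<open>
  The invariant of a pass: after the prefix \<open>us\<close> of the input, the counter value is at most
  \<open>W\<close> times the length of \<open>us\<close>.
\<close>

lemma counter_run_Read:
  assumes W: "\<And>h x. h \<in> H \<Longrightarrow> x \<in> X \<Longrightarrow> \<delta> h x \<in> H \<and> \<bar>\<omega> j h x\<bar> \<le> int W"
    and "vs \<in> lists X" and "h \<in> H" and "\<bar>signed_value s c\<bar> \<le> int (W * length us)"
  shows "\<exists>s' c'. signed_value s' c' = signed_value s c + run_weight \<delta> (\<omega> j) h vs \<and>
    counter_run weight_program (us @ vs) (W * length (us @ vs)) (Read j h s, Suc (length us), c, v)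
      (Read j (foldl \<delta> h vs) s', Suc (length (us @ vs)), c', v)"
  using assms(2-)
proof (induction vs arbitrary: us h s c rule: list.induct)
  case Nil
  then show ?case
    by (intro exI[of _ s] exI[of _ c]) (simp add: counter_run_refl)
next
  case (Cons x vs)
  let ?w = "us @ x # vs" and ?K = "W * length (us @ x # vs)"
  have wx: "\<delta> h x \<in> H" "\<bar>\<omega> j h x\<bar> \<le> int W"
    using W Cons.prems by auto
  have K: "int (W * length us) + int W \<le> int ?K"
    by (simp add: algebra_simps)
  have c: "c \<le> ?K"
    using Cons.prems(3) K abs_signed_value[of s c] by linarith
  have "\<bar>signed_value s c\<bar> \<le> int ?K" "\<bar>signed_value s c + \<omega> j h x\<bar> \<le> int ?K"
    using Cons.prems(3) K wx by linarith+
  from counter_run_Add[OF this] obtain s1 c1 where 1: "signed_value s1 c1 = signed_value s c + \<omega> j h x"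
    "counter_run weight_program ?w ?K (Add j (\<delta> h x) s (\<omega> j h x), Suc (Suc (length us)), c, v)
       (Read j (\<delta> h x) s1, Suc (Suc (length us)), c1, v)"
    by blast
  have "\<bar>signed_value s1 c1\<bar> \<le> int (W * length (us @ [x]))"
    using 1(1) Cons.prems(3) wx by (simp add: algebra_simps)
  then obtain s' c' where 2: "signed_value s' c' = signed_value s1 c1 + run_weight \<delta> (\<omega> j) (\<delta> h x) vs"
    "counter_run weight_program ?w ?K (Read j (\<delta> h x) s1, Suc (Suc (length us)), c1, v)
       (Read j (foldl \<delta> h (x # vs)) s', Suc (length ?w), c', v)"
    using Cons.IH[of "\<delta> h x" s1 c1 "us @ [x]"] wx Cons.prems by auto
  have "counter_run weight_program ?w ?K (Read j h s, Suc (length us), c, v)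
      (Add j (\<delta> h x) s (\<omega> j h x), Suc (Suc (length us)), c, v)"
    using c by (intro counter_run_step[OF _ _ counter_run_refl]) auto
  with 1 2 show ?case
    by (intro exI[of _ s'] exI[of _ c']) (auto intro: counter_run_trans)
qed

lemma counter_run_Emit:
  "c \<le> K \<Longrightarrow> counter_run weight_program w K (Emit j s, i, c, v)
     (Rewind (j + 1), i, 0, v @ signed_power (p j) (m j) (signed_value s c))"
proof (induction c arbitrary: v)
  case 0
  then show ?case
    by (intro counter_run_step[OF _ _ counter_run_refl]) (auto simp: signed_power_def signed_value_def)
next
  case (Suc c)
  have eq: "v @ signed_power (p j) (m j) (signed_value s (Suc c)) =
      (v @ [if s then m j else p j]) @ signed_power (p j) (m j) (signed_value s c)"
    by (auto simp: signed_power_def signed_value_def nat_add_distrib)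
  have put: "counter_run weight_program w K (Put j s, i, c, v)
     (Rewind (j + 1), i, 0, v @ signed_power (p j) (m j) (signed_value s (Suc c)))"
    unfolding eq using Suc by (intro counter_run_step[OF _ _ Suc.IH]) auto
  then show ?case
    using Suc.prems by (intro counter_run_step[OF _ _ put]) auto
qed

lemma counter_run_Rewind:
  "i \<le> Suc (length w) \<Longrightarrow>
     counter_run weight_program w K (Rewind j, i, 0, v) (Read j h\<^sub>0 False, 0, 0, v)"
proof (induction i)
  case 0
  then show ?case by (intro counter_run_step[OF _ _ counter_run_refl]) auto
next
  case (Suc i)
  have "input_cell w (Suc i) \<noteq> Left_End" by (simp add: input_cell_def)
  then show ?case
    using Suc by (intro counter_run_step[OF _ _ Suc.IH]) auto
qed

lemma counter_run_pass:
  assumes W: "\<And>h x. h \<in> H \<Longrightarrow> x \<in> X \<Longrightarrow> \<delta> h x \<in> H \<and> \<bar>\<omega> j h x\<bar> \<le> int W"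
    and "w \<in> lists X" and "h\<^sub>0 \<in> H"
  shows "\<exists>s c. signed_value s c = run_weight \<delta> (\<omega> j) h\<^sub>0 w \<and> c \<le> W * length w \<and>
    counter_run weight_program w (W * length w) (Read j h\<^sub>0 False, 0, 0, v)
      (Read j (foldl \<delta> h\<^sub>0 w) s, Suc (length w), c, v)"
proof -
  have *: "\<exists>s c. signed_value s c = run_weight \<delta> (\<omega> j) h\<^sub>0 w \<and>
    counter_run weight_program w (W * length w) (Read j h\<^sub>0 False, Suc 0, 0, v)
      (Read j (foldl \<delta> h\<^sub>0 w) s, Suc (length w), c, v)"
    using counter_run_Read[of H X j W w h\<^sub>0 False 0 "[]" v] assms by simp
  have "\<bar>run_weight \<delta> (\<omega> j) h w\<bar> \<le> int (W * length w)" if "h \<in> H" "w \<in> lists X" for h w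
    using that
  proof (induction w arbitrary: h rule: list.induct)
    case (Cons x w)
    then have "\<bar>run_weight \<delta> (\<omega> j) (\<delta> h x) w\<bar> \<le> int (W * length w)" "\<bar>\<omega> j h x\<bar> \<le> int W"
      using W by auto
    then show ?case by (simp add: algebra_simps)
  qed simp
  then have "\<bar>run_weight \<delta> (\<omega> j) h\<^sub>0 w\<bar> \<le> int (W * length w)"
    using assms by blast
  moreover from * obtain s c where sc: "signed_value s c = run_weight \<delta> (\<omega> j) h\<^sub>0 w"
    "counter_run weight_program w (W * length w) (Read j h\<^sub>0 False, Suc 0, 0, v)
      (Read j (foldl \<delta> h\<^sub>0 w) s, Suc (length w), c, v)"
    by blast
  ultimately have "c \<le> W * length w"
    using abs_signed_value[of s c] by linarith
  have "counter_run weight_program w (W * length w) (Read j h\<^sub>0 False, 0, 0, v)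
      (Read j (foldl \<delta> h\<^sub>0 w) s, Suc (length w), c, v)"
    by (intro counter_run_step[OF _ _ sc(2)]) auto
  with sc(1) \<open>c \<le> W * length w\<close> show ?thesis by blast
qed

definition weight_word :: "'x list \<Rightarrow> 'y list" where
  "weight_word w =
     concat (map (\<lambda>j. signed_power (p j) (m j) (run_weight \<delta> (\<omega> j) h\<^sub>0 w)) [1..<n + 1])
       @ \<rho> (foldl \<delta> h\<^sub>0 w)"

text \<open>
  Induction from the last pass back to the first, which is why the start is an arbitrary pass
  \<open>j\<close> with an arbitrary output \<open>v\<close>.
\<close>

lemma counter_run_weight_program:
  assumes W: "\<And>j h x. j \<le> n + 1 \<Longrightarrow> h \<in> H \<Longrightarrow> x \<in> X \<Longrightarrow> \<delta> h x \<in> H \<and> \<bar>\<omega> j h x\<bar> \<le> int W"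
    and w: "w \<in> lists X" and h\<^sub>0: "h\<^sub>0 \<in> H" and j: "j \<le> n + 1"
  shows "\<exists>i c. counter_run weight_program w (W * length w) (Read j h\<^sub>0 False, 0, 0, v)
    (Done, i, c, v @ concat (map (\<lambda>j. signed_power (p j) (m j) (run_weight \<delta> (\<omega> j) h\<^sub>0 w)) [j..<n + 1])
       @ \<rho> (foldl \<delta> h\<^sub>0 w))"
proof -
  note pass = counter_run_pass[OF W w h\<^sub>0]
  show ?thesis
    using j
  proof (induction j arbitrary: v rule: inc_induct)
    case base
    obtain s c where sc: "c \<le> W * length w"
      "counter_run weight_program w (W * length w) (Read (n + 1) h\<^sub>0 False, 0, 0, v)
        (Read (n + 1) (foldl \<delta> h\<^sub>0 w) s, Suc (length w), c, v)"
      using pass[of "n + 1" v] by auto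
    have "counter_run weight_program w (W * length w)
        (Read (n + 1) (foldl \<delta> h\<^sub>0 w) s, Suc (length w), c, v)
        (Done, Suc (length w), c, v @ \<rho> (foldl \<delta> h\<^sub>0 w))"
      using sc(1) by (intro counter_run_step[OF _ _ counter_run_refl]) auto
    with sc(2) show ?case
      by (auto intro: counter_run_trans)
  next
    case (step j)
    let ?u = "signed_power (p j) (m j) (run_weight \<delta> (\<omega> j) h\<^sub>0 w)"
    obtain s c where sc: "signed_value s c = run_weight \<delta> (\<omega> j) h\<^sub>0 w" "c \<le> W * length w"
      "counter_run weight_program w (W * length w) (Read j h\<^sub>0 False, 0, 0, v)
        (Read j (foldl \<delta> h\<^sub>0 w) s, Suc (length w), c, v)"
      using pass[of j v] step.hyps by auto
    have emit: "counter_run weight_program w (W * length w)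
        (Read j (foldl \<delta> h\<^sub>0 w) s, Suc (length w), c, v) (Emit j s, Suc (length w), c, v)"
      using sc(2) step.hyps by (intro counter_run_step[OF _ _ counter_run_refl]) auto
    have power: "counter_run weight_program w (W * length w)
        (Emit j s, Suc (length w), c, v) (Rewind (j + 1), Suc (length w), 0, v @ ?u)"
      using counter_run_Emit[OF sc(2), of w j s "Suc (length w)" v] sc(1) by simp
    have rewind: "counter_run weight_program w (W * length w)
        (Rewind (j + 1), Suc (length w), 0, v @ ?u) (Read (j + 1) h\<^sub>0 False, 0, 0, v @ ?u)"
      by (rule counter_run_Rewind) simp
    have 1: "counter_run weight_program w (W * length w) (Read j h\<^sub>0 False, 0, 0, v)
        (Read (Suc j) h\<^sub>0 False, 0, 0, v @ ?u)"
      using counter_run_trans[OF sc(3) counter_run_trans[OF emit counter_run_trans[OF power rewind]]]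
      by simp
    have "[j..<n + 1] = j # [Suc j..<n + 1]"
      using step.hyps by (simp add: upt_rec)
    moreover obtain i c where "counter_run weight_program w (W * length w)
        (Read (Suc j) h\<^sub>0 False, 0, 0, v @ ?u)
        (Done, i, c, (v @ ?u) @ concat (map (\<lambda>j. signed_power (p j) (m j) (run_weight \<delta> (\<omega> j) h\<^sub>0 w))
           [Suc j..<n + 1]) @ \<rho> (foldl \<delta> h\<^sub>0 w))"
      using step.IH by blast
    from counter_run_trans[OF 1 this] have "?case" if "[j..<n + 1] = j # [Suc j..<n + 1]"
      unfolding that by (intro exI[of _ i] exI[of _ c]) simp
    ultimately show ?case by blast
  qed
qed

text \<open>
  The weights of finitely many letters in finitely many states are bounded by some \<open>W\<close>. This
  bound makes the state space finite, as the summand \<open>k\<close> in \<open>Add j h s k\<close> ranges over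
  \<open>{- W..W}\<close>, and makes the counter linear in the length of the input.
\<close>

theorem logspace_computable_weight_word:
  assumes "finite X" and "finite H" and h\<^sub>0: "h\<^sub>0 \<in> H"
    and \<delta>: "\<And>h x. h \<in> H \<Longrightarrow> x \<in> X \<Longrightarrow> \<delta> h x \<in> H"
    and pm: "\<And>j. j \<in> {1..n} \<Longrightarrow> p j \<in> Y \<and> m j \<in> Y"
    and \<rho>: "\<And>h. h \<in> H \<Longrightarrow> \<rho> h \<in> lists Y"
  shows "logspace_computable X Y weight_word"
proof -
  define Ws where "Ws = (\<lambda>(j, h, x). nat \<bar>\<omega> j h x\<bar>) ` ({..n + 1} \<times> H \<times> X)"
  have "finite Ws" using assms by (simp add: Ws_def)
  \<comment> \<open>The element \<open>0\<close> keeps the maximum defined when \<open>X\<close> is empty.\<close>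
  define W where "W = Max (insert 0 Ws)"
  have W: "\<bar>\<omega> j h x\<bar> \<le> int W" if "j \<le> n + 1" "h \<in> H" "x \<in> X" for j h x
  proof -
    have "nat \<bar>\<omega> j h x\<bar> \<in> Ws" using that by (force simp: Ws_def)
    then have "nat \<bar>\<omega> j h x\<bar> \<le> W" using \<open>finite Ws\<close> by (simp add: W_def)
    then show ?thesis by linarith
  qed
  \<comment> \<open>The lower bound \<open>1\<close> is for the single letters that \<open>Put\<close> writes.\<close>
  define b where "b = Max (insert 1 ((length \<circ> \<rho>) ` H))"
  have b: "length (\<rho> h) \<le> b" if "h \<in> H" for h
    using that assms(2) by (simp add: b_def)
  have b1: "1 \<le> b" using assms(2) by (simp add: b_def)
  define Q where "Q = {q. case q of
      Read j h s \<Rightarrow> j \<in> {1..n + 1} \<and> h \<in> H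
    | Add j h s k \<Rightarrow> j \<in> {1..n + 1} \<and> h \<in> H \<and> k \<in> {- int W..int W}
    | Emit j s \<Rightarrow> j \<in> {1..n}
    | Put j s \<Rightarrow> j \<in> {1..n}
    | Rewind j \<Rightarrow> j \<in> {1..n + 1}
    | Done \<Rightarrow> True}"
  have Q_iff: "Read j h s \<in> Q \<longleftrightarrow> j \<in> {1..n + 1} \<and> h \<in> H"
    "Add j h s k \<in> Q \<longleftrightarrow> j \<in> {1..n + 1} \<and> h \<in> H \<and> k \<in> {- int W..int W}"
    "Emit j s \<in> Q \<longleftrightarrow> j \<in> {1..n}" "Put j s \<in> Q \<longleftrightarrow> j \<in> {1..n}"
    "Rewind j \<in> Q \<longleftrightarrow> j \<in> {1..n + 1}" "Done \<in> Q" for j h s k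
    by (simp_all add: Q_def)
  let ?img = "(\<lambda>(j, h, s). Read j h s) ` ({1..n + 1} \<times> H \<times> UNIV)
    \<union> (\<lambda>(j, h, s, k). Add j h s k) ` ({1..n + 1} \<times> H \<times> UNIV \<times> {- int W..int W})
    \<union> (\<lambda>(j, s). Emit j s) ` ({1..n} \<times> UNIV) \<union> (\<lambda>(j, s). Put j s) ` ({1..n} \<times> UNIV)
    \<union> Rewind ` {1..n + 1} \<union> {Done}"
  have "q \<in> ?img" if "q \<in> Q" for q
    using that by (cases q) (simp_all add: Q_iff image_iff Bex_def)
  moreover have "finite ?img" using assms(2) by simp
  ultimately have "finite Q" by (meson finite_subset subsetI)
  have "is_counter_program X Y Q weight_program"
    unfolding is_counter_program_def
  proof (intro conjI exI[of _ b] ballI)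
    fix q a assume q: "q \<in> Q" and a: "a \<in> cells X"
    show "case weight_program q a of Halt \<Rightarrow> True | Incr r \<Rightarrow> r \<in> Q
        | Decr r r' \<Rightarrow> r \<in> Q \<and> r' \<in> Q | Act d u r \<Rightarrow> r \<in> Q \<and> u \<in> lists Y \<and> length u \<le> b"
    proof (cases q)
      case (Read j h s)
      have "- int W \<le> \<omega> j h x \<and> \<omega> j h x \<le> int W" if "x \<in> X" for x
        using W[of j h x] that q Read Q_iff by auto
      then show ?thesis
        using q a Read Q_iff \<delta> \<rho> b by (auto simp: cells_def)
    next
      case (Add j h s k)
      then show ?thesis
        using q Q_iff by (auto simp: sgn_if)
    qed (use q a pm b1 h\<^sub>0 Q_iff in auto)
  qed fact
  moreover have "Read 1 h\<^sub>0 False \<in> Q"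
    using h\<^sub>0 by (simp add: Q_iff)
  moreover have "\<exists>C. counter_run weight_program w (W * (length w + 1)) (Read 1 h\<^sub>0 False, 0, 0, []) C \<and>
      counter_step weight_program w C = None \<and> snd (snd (snd C)) = weight_word w"
    if w: "w \<in> lists X" for w
  proof -
    obtain i c where *: "counter_run weight_program w (W * length w) (Read 1 h\<^sub>0 False, 0, 0, [])
        (Done, i, c, weight_word w)"
      using counter_run_weight_program[of H X W w 1 "[]"] W \<delta> w h\<^sub>0 unfolding weight_word_def by auto
    have "counter_run weight_program w (W * (length w + 1)) (Read 1 h\<^sub>0 False, 0, 0, [])
        (Done, i, c, weight_word w)"
      using * unfolding counter_run_def
      by (rule rtranclp_mono[THEN predicate2D, rotated]) auto
    then show ?thesis by force
  qed
  ultimately show ?thesis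
    by (rule logspace_computable_if_counter_program)
qed

end


section \<open>Values of words\<close>

lemma (in group) word_val_closed: "w \<in> lists (carrier G) \<Longrightarrow> word_val G w \<in> carrier G"
  by (induction w) (auto simp: word_val_def)

lemma word_val_simps [simp]:
  "word_val G [] = \<one>\<^bsub>G\<^esub>" "word_val G (x # w) = x \<otimes>\<^bsub>G\<^esub> word_val G w"
  by (simp_all add: word_val_def)

lemma (in group) word_val_append:
  "u \<in> lists (carrier G) \<Longrightarrow> v \<in> lists (carrier G) \<Longrightarrow>
    word_val G (u @ v) = word_val G u \<otimes> word_val G v"
proof (induction u rule: list.induct)
  case (Cons x u)
  then show ?case by (simp add: m_assoc word_val_closed)
qed (simp add: word_val_closed)

lemma (in group) word_val_power_word:
  assumes "x \<in> carrier G"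
  shows "word_val G (power_word G x k) = x [^] k"
proof -
  have *: "word_val G (replicate l y) = y [^] l" if "y \<in> carrier G" for l :: nat and y
    using that by (induction l) (simp_all add: nat_pow_Suc2[symmetric])
  show ?thesis
  proof (cases "k \<ge> 0")
    case True
    then have "x [^] nat k = x [^] k" by (rule pow_nat)
    with True show ?thesis
      using *[OF assms, of "nat k"] by (simp add: power_word_def)
  next
    case False
    define l where "l = nat (- k)"
    have k: "k = - int l" using False by (simp add: l_def)
    have "x [^] k = (inv x) [^] l"
      unfolding k using assms by (simp add: int_pow_neg_int nat_pow_inv)
    with False show ?thesis
      using *[OF inv_closed[OF assms], of l] by (simp add: power_word_def l_def)
  qed
qed

lemma power_word_in_lists: "x \<in> X \<Longrightarrow> inv\<^bsub>G\<^esub> x \<in> X \<Longrightarrow> power_word G x k \<in> lists X"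
  by (auto simp: power_word_def)

section \<open>Products of powers in abelian groups\<close>

definition power_prod :: "('a, 'b) monoid_scheme \<Rightarrow> ('i \<Rightarrow> 'a) \<Rightarrow> 'i set \<Rightarrow> ('i \<Rightarrow> int) \<Rightarrow> 'a" where
  "power_prod G t I \<alpha> = finprod G (\<lambda>i. t i [^]\<^bsub>G\<^esub> \<alpha> i) I"

definition mult_independent :: "('a, 'b) monoid_scheme \<Rightarrow> ('i \<Rightarrow> 'a) \<Rightarrow> 'i set \<Rightarrow> bool" where
  "mult_independent G t I \<longleftrightarrow> (\<forall>\<alpha>. power_prod G t I \<alpha> = \<one>\<^bsub>G\<^esub> \<longrightarrow> (\<forall>i \<in> I. \<alpha> i = 0))"

context comm_group
begin

lemma power_prod_closed [simp]: "t ` I \<subseteq> carrier G \<Longrightarrow> power_prod G t I \<alpha> \<in> carrier G"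
  unfolding power_prod_def by (intro finprod_closed) auto

lemma power_prod_cong:
  "t ` I \<subseteq> carrier G \<Longrightarrow> (\<And>i. i \<in> I \<Longrightarrow> \<alpha> i = \<beta> i) \<Longrightarrow> power_prod G t I \<alpha> = power_prod G t I \<beta>"
  unfolding power_prod_def by (intro finprod_cong') auto

lemma power_prod_add:
  assumes "t ` I \<subseteq> carrier G"
  shows "power_prod G t I (\<lambda>i. \<alpha> i + \<beta> i) = power_prod G t I \<alpha> \<otimes> power_prod G t I \<beta>"
proof -
  have "power_prod G t I (\<lambda>i. \<alpha> i + \<beta> i) = finprod G (\<lambda>i. t i [^] \<alpha> i \<otimes> t i [^] \<beta> i) I"
    unfolding power_prod_def using assms by (intro finprod_cong') (auto simp: int_pow_mult)
  also have "\<dots> = power_prod G t I \<alpha> \<otimes> power_prod G t I \<beta>"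
    unfolding power_prod_def using assms by (intro finprod_multf) auto
  finally show ?thesis .
qed

lemma power_prod_zero [simp]: "power_prod G t I (\<lambda>_. 0) = \<one>"
  by (simp add: power_prod_def)

lemma power_prod_uminus:
  assumes "t ` I \<subseteq> carrier G"
  shows "power_prod G t I (\<lambda>i. - \<alpha> i) = inv (power_prod G t I \<alpha>)"
proof (rule sym, rule inv_equality)
  have "power_prod G t I (\<lambda>i. - \<alpha> i + \<alpha> i) = \<one>" by simp
  then show "power_prod G t I (\<lambda>i. - \<alpha> i) \<otimes> power_prod G t I \<alpha> = \<one>"
    using power_prod_add[OF assms, of "\<lambda>i. - \<alpha> i" \<alpha>] by simp
qed (use assms in auto)

lemma power_prod_insert:
  assumes "finite I" "i \<notin> I" "t ` insert i I \<subseteq> carrier G"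
  shows "power_prod G t (insert i I) \<alpha> = t i [^] \<alpha> i \<otimes> power_prod G t I \<alpha>"
  unfolding power_prod_def using assms by (intro finprod_insert) auto

lemma power_prod_single:
  assumes "finite I" "i \<in> I" "t ` I \<subseteq> carrier G"
  shows "power_prod G t I (\<lambda>j. if j = i then 1 else 0) = t i"
proof -
  have "power_prod G t I (\<lambda>j. if j = i then 1 else 0) = finprod G (\<lambda>j. if i = j then t j else \<one>) I"
    unfolding power_prod_def using assms by (intro finprod_cong') auto
  also have "\<dots> = t i"
    using assms by (intro finprod_singleton) auto
  finally show ?thesis .
qed

lemma subgroup_range_power_prod:
  assumes "t ` I \<subseteq> carrier G"
  shows "subgroup (range (power_prod G t I)) G"
proof (rule subgroupI)
  show "range (power_prod G t I) \<subseteq> carrier G"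
    using assms by auto
  show "inv g \<in> range (power_prod G t I)" if "g \<in> range (power_prod G t I)" for g
    using that by (auto simp: power_prod_uminus[OF assms, symmetric])
  show "g \<otimes> g' \<in> range (power_prod G t I)" if "g \<in> range (power_prod G t I)" "g' \<in> range (power_prod G t I)" for g g'
    using that by (auto simp: power_prod_add[OF assms, symmetric])
qed auto

lemma generate_subset_range_power_prod:
  assumes "finite I" "t ` I \<subseteq> carrier G"
  shows "generate G (t ` I) \<subseteq> range (power_prod G t I)"
proof -
  have "t ` I \<subseteq> range (power_prod G t I)"
    using power_prod_single[OF assms(1) _ assms(2)] by (metis image_subsetI rangeI)
  then show ?thesis
    using generate_subgroup_incl subgroup_range_power_prod[OF assms(2)] by blast
qed

lemma independent_unique:
  assumes "mult_independent G t I" "t ` I \<subseteq> carrier G" "power_prod G t I \<alpha> = power_prod G t I \<beta>" "i \<in> I"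
  shows "\<alpha> i = \<beta> i"
proof -
  have "power_prod G t I (\<lambda>i. \<alpha> i + - \<beta> i) = \<one>"
    using assms(2,3) by (subst power_prod_add) (simp_all add: power_prod_uminus)
  then have "\<alpha> i + - \<beta> i = 0"
    using assms(1,4) unfolding mult_independent_def by blast
  then show ?thesis by simp
qed

section \<open>Free abelian subgroups of finite index\<close>

text \<open>
  A maximal independent subset of the generators will span a free abelian subgroup of finite
  index.
\<close>

lemma maximal_independent_subset:
  assumes "finite I"
  obtains J where "J \<subseteq> I" "mult_independent G t J" "\<And>i. i \<in> I - J \<Longrightarrow> \<not> mult_independent G t (insert i J)"
proof -
  let ?\<J> = "{J. J \<subseteq> I \<and> mult_independent G t J}"
  have "{} \<in> ?\<J>"
    by (simp add: mult_independent_def)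
  then have "?\<J> \<noteq> {}" by blast
  moreover have "finite ?\<J>"
    using assms by simp
  ultimately obtain J where J: "J \<in> ?\<J>" and "\<forall>J' \<in> ?\<J>. J \<subseteq> J' \<longrightarrow> J = J'"
    using finite_has_maximal by metis
  then have max: "\<And>J'. J' \<subseteq> I \<Longrightarrow> mult_independent G t J' \<Longrightarrow> J \<subseteq> J' \<Longrightarrow> J = J'"
    by simp
  have "\<not> mult_independent G t (insert i J)" if "i \<in> I - J" for i
    using max[of "insert i J"] J that by blast
  with J show thesis
    using that[of J] by simp
qed

text \<open>
  A relation that involves \<open>J\<close> and one more element \<open>i\<close> has a nonzero exponent at
  \<open>i\<close>, since \<open>J\<close> alone admits no relation. Solving the relation for that power of
  \<open>t i\<close> puts it into the subgroup generated by \<open>J\<close>.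
\<close>

lemma power_in_range_power_prod_if_dependent:
  assumes J: "finite J" "mult_independent G t J" and i: "i \<notin> J" "\<not> mult_independent G t (insert i J)"
    and car: "t ` insert i J \<subseteq> carrier G"
  shows "\<exists>m > 0. t i [^] (m :: int) \<in> range (power_prod G t J)"
proof -
  obtain \<alpha> k where \<alpha>: "power_prod G t (insert i J) \<alpha> = \<one>" "k \<in> insert i J" "\<alpha> k \<noteq> 0"
    using i(2) unfolding mult_independent_def by blast
  have eq: "t i [^] \<alpha> i \<otimes> power_prod G t J \<alpha> = \<one>"
    using \<alpha>(1) power_prod_insert[OF J(1) i(1) car] by simp
  have ti: "t i \<in> carrier G" and tJ: "t ` J \<subseteq> carrier G" using car by auto
  have "\<alpha> i \<noteq> 0"
  proof
    assume "\<alpha> i = 0"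
    then have "power_prod G t J \<alpha> = \<one>" using eq tJ by simp
    then show False
      using \<alpha>(2,3) \<open>\<alpha> i = 0\<close> J(2) unfolding mult_independent_def by auto
  qed
  have pos: "t i [^] \<alpha> i \<in> range (power_prod G t J)"
  proof -
    have "t i [^] \<alpha> i = inv (power_prod G t J \<alpha>)"
      using eq ti tJ by (metis power_prod_closed int_pow_closed inv_equality inv_inv)
    then show ?thesis using power_prod_uminus[OF tJ, of \<alpha>] by (metis rangeI)
  qed
  moreover have "t i [^] (- \<alpha> i) \<in> range (power_prod G t J)"
    using pos subgroup.m_inv_closed[OF subgroup_range_power_prod[OF tJ]] ti by (simp add: int_pow_neg)
  ultimately show ?thesis
    using \<open>\<alpha> i \<noteq> 0\<close> by (cases "\<alpha> i > 0") (auto intro: exI[of _ "\<alpha> i"] exI[of _ "- \<alpha> i"])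
qed

lemma finprod_in_subgroup: "subgroup A G \<Longrightarrow> f \<in> I \<rightarrow> A \<Longrightarrow> finprod G f I \<in> A"
proof (induction I rule: infinite_finite_induct)
  case (insert i I)
  then have "f \<in> I \<rightarrow> carrier G" "f i \<in> carrier G"
    using subgroup.subset by fastforce+
  then show ?case
    using insert by (auto intro: subgroup.m_closed)
qed (auto intro: subgroup.one_closed)

text \<open>
  If a power of each generator lies in \<open>A\<close>, then \<open>A\<close> has finite index: reducing each
  exponent modulo the corresponding \<open>m i\<close> changes a product of powers by an element of
  \<open>A\<close>, and only finitely many reduced exponent vectors exist.
\<close>

lemma finite_representatives:
  assumes I: "finite I" "t ` I \<subseteq> carrier G" "carrier G \<subseteq> range (power_prod G t I)"
    and A: "subgroup A G" and torsion: "\<And>i. i \<in> I \<Longrightarrow> \<exists>m > 0. t i [^] (m :: int) \<in> A"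
  obtains F where "finite F" "F \<subseteq> carrier G" "\<And>g. g \<in> carrier G \<Longrightarrow> \<exists>h \<in> F. g \<otimes> inv h \<in> A"
proof -
  obtain m :: "'c \<Rightarrow> int" where m: "\<And>i. i \<in> I \<Longrightarrow> m i > 0 \<and> t i [^] m i \<in> A"
    using torsion by metis
  let ?F = "power_prod G t I ` (\<Pi>\<^sub>E i \<in> I. {0..<m i})"
  have fin: "finite ?F" using I(1) by (intro finite_imageI finite_PiE) auto
  have sub: "?F \<subseteq> carrier G" using I(2) by auto
  have "\<exists>h \<in> ?F. g \<otimes> inv h \<in> A" if "g \<in> carrier G" for g
  proof -
    from that obtain \<alpha> where g: "g = power_prod G t I \<alpha>" using I(3) by blast
    define h where "h = power_prod G t I (\<lambda>i \<in> I. \<alpha> i mod m i)"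
    have "(\<lambda>i \<in> I. \<alpha> i mod m i) \<in> (\<Pi>\<^sub>E i \<in> I. {0..<m i})"
      using m by auto
    then have "h \<in> ?F" unfolding h_def by blast
    moreover have "g \<otimes> inv h \<in> A"
    proof -
      define a where "a = power_prod G t I (\<lambda>i. m i * (\<alpha> i div m i))"
      have "a \<in> A"
        unfolding a_def power_prod_def
      proof (intro finprod_in_subgroup[OF A] funcsetI)
        fix i assume i: "i \<in> I"
        then have "t i [^] (m i * (\<alpha> i div m i)) = (t i [^] m i) [^] (\<alpha> i div m i)"
          using I(2) by (intro int_pow_pow[symmetric]) auto
        then show "t i [^] (m i * (\<alpha> i div m i)) \<in> A"
          using m[OF i] A by (simp add: subgroup_int_pow_closed)
      qed
      have "g = power_prod G t I (\<lambda>i. m i * (\<alpha> i div m i) + (\<lambda>i \<in> I. \<alpha> i mod m i) i)"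
        unfolding g using I(2) by (intro power_prod_cong) auto
      then have "g = a \<otimes> h"
        unfolding a_def h_def by (simp only: power_prod_add[OF I(2)])
      moreover have "a \<in> carrier G" "h \<in> carrier G"
        unfolding a_def h_def using I(2) by auto
      ultimately have "g \<otimes> inv h = a"
        by (simp add: m_assoc)
      with \<open>a \<in> A\<close> show ?thesis by simp
    qed
    ultimately show ?thesis by blast
  qed
  with fin sub show thesis by (rule that)
qed

text \<open>
  Representatives are chosen by a function \<open>r\<close> that depends on the coset only; it is made to
  return \<open>\<one>\<close> on \<open>A\<close> so that \<open>\<one>\<close>, the value of the empty word, can be
  the initial state of an automaton with the representatives as states.
\<close>

lemma finite_transversal:
  assumes A: "subgroup A G" and F: "finite F" "F \<subseteq> carrier G"
    and cover: "\<And>g. g \<in> carrier G \<Longrightarrow> \<exists>h \<in> F. g \<otimes> inv h \<in> A"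
  obtains T where "finite T" "T \<subseteq> carrier G" "\<one> \<in> T"
    "\<And>g. g \<in> carrier G \<Longrightarrow> \<exists>!h. h \<in> T \<and> g \<otimes> inv h \<in> A"
proof
  define r where "r g = (if g \<in> A then \<one> else SOME h. h \<in> F \<and> g \<otimes> inv h \<in> A)" for g
  have A_sub: "A \<subseteq> carrier G" using A by (rule subgroup.subset)
  have r: "r g \<in> insert \<one> F \<and> g \<otimes> inv (r g) \<in> A" if "g \<in> carrier G" for g
    using someI_ex[of "\<lambda>h. h \<in> F \<and> g \<otimes> inv h \<in> A"] cover[OF that] that
    by (auto simp: r_def)
  have trans: "x \<otimes> inv z \<in> A" if "x \<otimes> inv y \<in> A" "y \<otimes> inv z \<in> A"
    "x \<in> carrier G" "y \<in> carrier G" "z \<in> carrier G" for x y z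
  proof -
    have "(x \<otimes> inv y) \<otimes> (y \<otimes> inv z) = x \<otimes> inv z"
      using that by (metis inv_closed inv_solve_right m_assoc m_closed)
    then show ?thesis using that subgroup.m_closed[OF A] by metis
  qed
  have sym: "y \<otimes> inv x \<in> A" if "x \<otimes> inv y \<in> A" "x \<in> carrier G" "y \<in> carrier G" for x y
  proof -
    have "inv (x \<otimes> inv y) = y \<otimes> inv x"
      using that by (simp add: inv_mult m_comm)
    then show ?thesis using that subgroup.m_inv_closed[OF A] by metis
  qed
  \<comment> \<open>Both alternatives in the definition of \<open>r g\<close> depend only on the coset of \<open>g\<close>.\<close>
  have r_cong: "r x = r y" if "x \<otimes> inv y \<in> A" "x \<in> carrier G" "y \<in> carrier G" for x y
  proof -
    have "x \<in> A \<longleftrightarrow> y \<in> A"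
      using trans[of x y \<one>] trans[of y x \<one>] sym[of x y] that by auto
    moreover have "(h \<in> F \<and> x \<otimes> inv h \<in> A) \<longleftrightarrow> (h \<in> F \<and> y \<otimes> inv h \<in> A)" for h
      using trans[of x y h] trans[of y x h] sym[of x y] that F(2) by blast
    ultimately show ?thesis by (simp add: r_def)
  qed
  let ?T = "r ` carrier G"
  have T_sub: "?T \<subseteq> insert \<one> F" using r by blast
  then show "finite ?T" by (rule finite_subset) (simp add: F(1))
  show T_car: "?T \<subseteq> carrier G" using T_sub F(2) by (rule order_trans[OF _ insert_subsetI, OF _ one_closed])
  have "r \<one> = \<one>" using subgroup.one_closed[OF A] by (simp add: r_def)
  then show "\<one> \<in> ?T" using imageI[OF one_closed, of r] by simp
  fix g assume g: "g \<in> carrier G"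
  show "\<exists>!h. h \<in> ?T \<and> g \<otimes> inv h \<in> A"
  proof (intro ex1I[of _ "r g"])
    show "r g \<in> ?T \<and> g \<otimes> inv (r g) \<in> A" using g r by blast
    fix h assume h: "h \<in> ?T \<and> g \<otimes> inv h \<in> A"
    then obtain x where x: "x \<in> carrier G" "h = r x" by blast
    have hc: "h \<in> carrier G" using h T_car by auto
    have "r x = r h" using r_cong[of x h] r[OF x(1)] x hc by simp
    moreover have "r g = r h" using r_cong[of g h] h g hc by simp
    ultimately show "h = r g" using x(2) by simp
  qed
qed

section \<open>The normal form function\<close>

lemma word_val_power_words:
  assumes "t ` {1..n} \<subseteq> carrier G"
  shows "concat (map (\<lambda>i. power_word G (t i) (\<alpha> i)) [1..<n + 1]) \<in> lists (carrier G) \<and>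
    word_val G (concat (map (\<lambda>i. power_word G (t i) (\<alpha> i)) [1..<n + 1])) = power_prod G t {1..n} \<alpha>"
  using assms
proof (induction n)
  case 0
  then show ?case by (simp add: power_prod_def)
next
  case (Suc n)
  let ?u = "concat (map (\<lambda>i. power_word G (t i) (\<alpha> i)) [1..<n + 1])"
  have t: "t (Suc n) \<in> carrier G" "t ` {1..n} \<subseteq> carrier G"
    using Suc.prems by auto
  have p: "power_word G (t (Suc n)) (\<alpha> (Suc n)) \<in> lists (carrier G)"
    using t by (intro power_word_in_lists) auto
  have "power_prod G t {1..Suc n} \<alpha> = power_prod G t {1..n} \<alpha> \<otimes> t (Suc n) [^] \<alpha> (Suc n)"
    using power_prod_insert[of "{1..n}" "Suc n" t \<alpha>] Suc.prems t
    by (simp add: atLeastAtMostSuc_conv m_comm)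
  moreover have "[1..<Suc n + 1] = [1..<n + 1] @ [Suc n]" by simp
  moreover have "word_val G (?u @ power_word G (t (Suc n)) (\<alpha> (Suc n)))
      = word_val G ?u \<otimes> word_val G (power_word G (t (Suc n)) (\<alpha> (Suc n)))"
    using Suc.IH[OF t(2)] p by (intro word_val_append) auto
  ultimately show ?case
    using Suc.IH[OF t(2)] p word_val_power_word[OF t(1)] by simp
qed

text \<open>
  The elements of the transversal \<open>T\<close> are the states of an automaton that reads a word
  letter by letter. In state \<open>h\<close>, reading \<open>x\<close>, it writes \<open>h \<otimes> x\<close> as
  \<open>a \<otimes> h'\<close> with \<open>a\<close> in the free abelian subgroup and \<open>h'\<close> in
  \<open>T\<close>, and moves to \<open>h'\<close>. As the group is abelian, the elements \<open>a\<close>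
  multiply up by adding their exponents, so the exponents of the normal form are total weights of
  the automaton.
\<close>

theorem logspace_normal_form_free_by_finite:
  fixes t :: "nat \<Rightarrow> 'a"
  assumes t: "t ` {1..n} \<subseteq> carrier G" "mult_independent G t {1..n}"
    and T: "finite T" "T \<subseteq> carrier G" "\<one> \<in> T"
      "\<And>g. g \<in> carrier G \<Longrightarrow> \<exists>!h. h \<in> T \<and> g \<otimes> inv h \<in> range (power_prod G t {1..n})"
    and X: "finite X" "X \<subseteq> carrier G" "symmetric_letters G n t \<subseteq> X"
    and \<rho>: "\<And>h. h \<in> T \<Longrightarrow> \<rho> h \<in> lists X \<and> word_val G (\<rho> h) = h"
  shows "\<exists>f. logspace_normal_form_function_onto G X
    {concat (map (\<lambda>i. power_word G (t i) (\<alpha> i)) [1..<n + 1]) @ \<rho> h | \<alpha> h. h \<in> T} f"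
proof -
  define I where "I = {1..n}"
  note t = t[folded I_def] and coset = T(4)[folded I_def]
  let ?c = "power_prod G t I"
  let ?u = "\<lambda>\<alpha>. concat (map (\<lambda>i. power_word G (t i) (\<alpha> i)) [1..<n + 1])"
  let ?L = "{?u \<alpha> @ \<rho> h | \<alpha> h. h \<in> T}"
  have c [simp]: "?c \<alpha> \<in> carrier G" for \<alpha> using t(1) by simp
  have ex: "\<exists>\<alpha> h. h \<in> T \<and> g = ?c \<alpha> \<otimes> h" if g: "g \<in> carrier G" for g
  proof -
    obtain h \<alpha> where h: "h \<in> T" "g \<otimes> inv h = ?c \<alpha>"
      using coset[OF g] by blast
    have hc: "h \<in> carrier G" using h(1) T(2) by auto
    have "g = ?c \<alpha> \<otimes> h"
      unfolding h(2)[symmetric] using g hc by (simp add: m_assoc)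
    with h(1) show ?thesis by blast
  qed
  \<comment> \<open>Both factors are determined: \<open>h\<close> by the coset, then \<open>\<alpha>\<close> by independence.\<close>
  have unique: "h = h' \<and> (\<forall>i \<in> I. \<alpha> i = \<beta> i)"
    if "?c \<alpha> \<otimes> h = ?c \<beta> \<otimes> h'" "h \<in> T" "h' \<in> T" for \<alpha> \<beta> h h'
  proof -
    have hc: "h \<in> carrier G" "h' \<in> carrier G" using that T(2) by auto
    have "(?c \<alpha> \<otimes> h) \<otimes> inv h = ?c \<alpha>" using hc by (simp add: m_assoc)
    moreover have "(?c \<alpha> \<otimes> h) \<otimes> inv h' = ?c \<beta>"
      unfolding that(1) using hc by (simp add: m_assoc)
    ultimately have "h = h'"
      using coset[of "?c \<alpha> \<otimes> h"] that(2,3) hc by (metis c m_closed rangeI)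
    with that(1) hc have "?c \<alpha> = ?c \<beta>" by simp
    with \<open>h = h'\<close> show ?thesis
      using independent_unique[OF t(2,1)] by blast
  qed
  obtain expo :: "'a \<Rightarrow> nat \<Rightarrow> int" and rest :: "'a \<Rightarrow> 'a"
    where split: "\<And>g. g \<in> carrier G \<Longrightarrow> rest g \<in> T \<and> g = ?c (expo g) \<otimes> rest g"
    using ex by metis
  \<comment> \<open>Machine states have to come from a countable type, so the elements of \<open>T\<close> are numbered.\<close>
  obtain e :: "'a \<Rightarrow> nat" where e: "inj_on e T"
    using finite_imp_inj_to_nat_seg[OF T(1)] by blast
  define d where "d = the_inv_into T e"
  have de [simp]: "d (e h) = h" if "h \<in> T" for h
    using e that by (simp add: d_def the_inv_into_f_f)
  define \<delta> where "\<delta> k x = e (rest (d k \<otimes> x))" for k x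
  define \<omega> where "\<omega> j k x = expo (d k \<otimes> x) j" for j k x
  define f where "f = weight_word n \<delta> \<omega> (e \<one>) t (\<lambda>i. inv (t i)) (\<lambda>k. \<rho> (d k))"
  have f: "f w = ?u (\<lambda>j. run_weight \<delta> (\<omega> j) (e \<one>) w) @ \<rho> (d (foldl \<delta> (e \<one>) w))" for w
    by (simp add: f_def weight_word_def signed_power_def power_word_def)
  have letters: "t i \<in> X" "inv (t i) \<in> X" if "i \<in> I" for i
    using X(3) that by (auto simp: symmetric_letters_def I_def)
  have \<rho>_letter: "y \<in> X" if "h \<in> T" "y \<in> set (\<rho> h)" for h y
    using \<rho>[OF that(1)] that(2) by auto
  have "logspace_computable X X f"
    unfolding f_def
  proof (rule logspace_computable_weight_word[of X "e ` T"])
    fix k x assume "k \<in> e ` T" "x \<in> X"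
    then have "d k \<otimes> x \<in> carrier G" using T(2) X(2) by (auto intro!: m_closed)
    then show "\<delta> k x \<in> e ` T" using split by (auto simp: \<delta>_def)
  qed (use X(1) T(1,3) letters[unfolded I_def] \<rho>_letter in auto)
  moreover have run: "d (foldl \<delta> (e h) w) \<in> T \<and>
      h \<otimes> word_val G w = ?c (\<lambda>j. run_weight \<delta> (\<omega> j) (e h) w) \<otimes> d (foldl \<delta> (e h) w)"
    if "w \<in> lists X" "h \<in> T" for w h
    using that
  proof (induction w arbitrary: h rule: list.induct)
    case Nil
    then show ?case using T(2) by auto
  next
    case (Cons x w)
    define g where "g = h \<otimes> x"
    have x: "x \<in> carrier G" "h \<in> carrier G" "w \<in> lists X" "w \<in> lists (carrier G)"
      using Cons.prems X(2) T(2) by auto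
    then have g: "g \<in> carrier G" by (simp add: g_def)
    note s = split[OF g]
    have \<delta>: "\<delta> (e h) x = e (rest g)" and \<omega>: "\<omega> j (e h) x = expo g j" for j
      using Cons.prems by (simp_all add: \<delta>_def \<omega>_def g_def)
    let ?k = "d (foldl \<delta> (e (rest g)) w)" and ?\<beta> = "\<lambda>j. run_weight \<delta> (\<omega> j) (e (rest g)) w"
    have IH: "?k \<in> T" "rest g \<otimes> word_val G w = ?c ?\<beta> \<otimes> ?k"
      using Cons.IH[of "rest g"] s x by auto
    have W: "word_val G w \<in> carrier G" using x by (intro word_val_closed)
    have rc: "rest g \<in> carrier G" "?k \<in> carrier G" using s IH T(2) by auto
    have "h \<otimes> word_val G (x # w) = g \<otimes> word_val G w"
      using x W by (simp add: g_def m_assoc)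
    also have "\<dots> = ?c (expo g) \<otimes> (rest g \<otimes> word_val G w)"
      using s rc W by (metis c m_assoc)
    also have "\<dots> = ?c (\<lambda>j. expo g j + ?\<beta> j) \<otimes> ?k"
      using rc by (simp add: IH(2) power_prod_add[OF t(1)] m_assoc)
    finally show ?case
      using IH(1) by (simp add: \<delta> \<omega>)
  qed
  have u: "?u \<alpha> \<in> lists X" for \<alpha>
    using power_word_in_lists[of "t i" X G "\<alpha> i" for i] letters unfolding I_def by fastforce
  have val: "word_val G (?u \<alpha> @ \<rho> h) = ?c \<alpha> \<otimes> h" if "h \<in> T" for \<alpha> h
    using word_val_power_words[OF t(1)[unfolded I_def], of \<alpha>, folded I_def] \<rho>[OF that] X(2) word_val_append
    by (metis lists_mono subsetD)
  have mem: "?u \<alpha> @ \<rho> h \<in> ?L" if "h \<in> T" for \<alpha> h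
    using that by blast
  have "normal_form G X ?L"
    unfolding normal_form_def
  proof
    show "?L \<subseteq> lists X" using u \<rho> by fastforce
    show "bij_betw (word_val G) ?L (carrier G)"
      unfolding bij_betw_def
    proof
      show "inj_on (word_val G) ?L"
      proof (rule inj_onI)
        fix v v' assume v: "v \<in> ?L" "v' \<in> ?L" and eq: "word_val G v = word_val G v'"
        from v obtain \<alpha> h \<beta> h' where *: "v = ?u \<alpha> @ \<rho> h" "h \<in> T" "v' = ?u \<beta> @ \<rho> h'" "h' \<in> T"
          by blast
        then have "?c \<alpha> \<otimes> h = ?c \<beta> \<otimes> h'"
          using eq val by metis
        from unique[OF this] * have "h = h'" "\<And>i. i \<in> I \<Longrightarrow> \<alpha> i = \<beta> i"
          by auto
        then have "?u \<alpha> = ?u \<beta>"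
          by (intro arg_cong[of _ _ concat] map_cong) (auto simp: I_def)
        with * \<open>h = h'\<close> show "v = v'" by metis
      qed
      show "word_val G ` ?L = carrier G"
      proof
        have "word_val G (?u \<alpha> @ \<rho> h) \<in> carrier G" if "h \<in> T" for \<alpha> h
          unfolding val[OF that] using T(2) that by auto
        then show "word_val G ` ?L \<subseteq> carrier G" by blast
        show "carrier G \<subseteq> word_val G ` ?L"
        proof
          fix g assume "g \<in> carrier G"
          then obtain \<alpha> h where *: "h \<in> T" "g = ?c \<alpha> \<otimes> h" using ex by blast
          then have "g = word_val G (?u \<alpha> @ \<rho> h)" using val by metis
          with * show "g \<in> word_val G ` ?L" by blast
        qed
      qed
    qed
  qed
  moreover have "f w \<in> ?L \<and> word_val G (f w) = word_val G w" if "w \<in> lists X" for w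
  proof -
    note r = run[OF that T(3)]
    have "word_val G w \<in> carrier G"
      using that X(2) by (intro word_val_closed) auto
    then have "word_val G (f w) = word_val G w"
      unfolding f using r by (subst val) auto
    moreover have "f w \<in> ?L"
      unfolding f by (rule mem[OF conjunct1[OF r]])
    ultimately show ?thesis by blast
  qed
  ultimately show ?thesis
    unfolding logspace_normal_form_function_onto_def by blast
qed

lemma finite_symmetric_generating_setI:
  assumes "finite S" "S \<subseteq> carrier G" "generate G S = carrier G"
  shows "finite_symmetric_generating_set G (S \<union> m_inv G ` S)"
proof -
  have "generate G S \<subseteq> generate G (S \<union> m_inv G ` S)"
    by (intro mono_generate) auto
  moreover have "generate G (S \<union> m_inv G ` S) \<subseteq> carrier G"
    using assms(2) by (intro generate_incl) auto
  ultimately have "generate G (S \<union> m_inv G ` S) = carrier G"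
    using assms(3) by blast
  moreover have "S \<union> m_inv G ` S \<subseteq> carrier G"
    using assms(2) by auto
  moreover have "inv x \<in> S \<union> m_inv G ` S" if "x \<in> S \<union> m_inv G ` S" for x
    using that assms(2) by auto
  ultimately show ?thesis
    using assms(1) unfolding finite_symmetric_generating_set_def by blast
qed

text \<open>
  The elements of the transversal are added to the generating set. Each of them is then
  represented by a word of a single letter.
\<close>

theorem finitely_generated_has_logspace_normal_form_function:
  assumes "finitely_generated G"
  shows "has_logspace_normal_form_function G"
proof -
  obtain S where S: "finite S" "S \<subseteq> carrier G" "generate G S = carrier G"
    using assms unfolding finitely_generated_def by blast
  let ?id = "\<lambda>s::'a. s"
  obtain B where B: "B \<subseteq> S" "mult_independent G ?id B"
    and max: "\<And>s. s \<in> S - B \<Longrightarrow> \<not> mult_independent G ?id (insert s B)"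
    using maximal_independent_subset[OF S(1)] by blast
  have finB: "finite B" using B(1) S(1) by (rule finite_subset)
  have Bc: "?id ` B \<subseteq> carrier G" using B(1) S(2) by auto
  let ?A = "range (power_prod G ?id B)"
  have A: "subgroup ?A G" using subgroup_range_power_prod[OF Bc] .
  have torsion: "\<exists>m > 0. s [^] (m :: int) \<in> ?A" if s: "s \<in> S" for s
  proof (cases "s \<in> B")
    case True
    then have "power_prod G ?id B (\<lambda>j. if j = s then 1 else 0) = s"
      using power_prod_single[OF finB _ Bc] by simp
    with rangeI[of "power_prod G ?id B"] have "s \<in> ?A" by metis
    moreover have "s [^] (1 :: int) = s" using s S(2) by auto
    ultimately show ?thesis by (metis zero_less_one)
  next
    case False
    then show ?thesis
      using power_in_range_power_prod_if_dependent[OF finB B(2) False] max s Bc S(2) by auto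
  qed
  have Sc: "?id ` S \<subseteq> carrier G" using S(2) by simp
  have "carrier G \<subseteq> range (power_prod G ?id S)"
    using generate_subset_range_power_prod[OF S(1) Sc] S(3) by simp
  from finite_representatives[OF S(1) Sc this A torsion]
  obtain F where F: "finite F" "F \<subseteq> carrier G"
      "\<And>g. g \<in> carrier G \<Longrightarrow> \<exists>h \<in> F. g \<otimes> inv h \<in> ?A"
    by blast
  obtain T where T: "finite T" "T \<subseteq> carrier G" "\<one> \<in> T"
      "\<And>g. g \<in> carrier G \<Longrightarrow> \<exists>!h. h \<in> T \<and> g \<otimes> inv h \<in> ?A"
    using finite_transversal[OF A F] by blast
  \<comment> \<open>Normal forms need an order on the basis, hence its enumeration by \<open>1, \<dots>, n\<close>.\<close>
  obtain t where t: "bij_betw t {1..card B} B"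
    using ex_bij_betw_nat_finite_1[OF finB] by blast
  define n where "n = card B"
  have tB: "t ` {1..n} = B" and inj: "inj_on t {1..n}"
    using t by (auto simp: bij_betw_def n_def)
  have reindex: "power_prod G ?id B \<alpha> = power_prod G t {1..n} (\<alpha> \<circ> t)" for \<alpha>
    using finprod_reindex[OF _ inj, of "\<lambda>b. b [^] \<alpha> b"] tB Bc by (auto simp: power_prod_def)
  have unindex: "power_prod G t {1..n} \<alpha> = power_prod G ?id B (\<alpha> \<circ> the_inv_into {1..n} t)" for \<alpha>
    unfolding reindex using tB Bc inj by (intro power_prod_cong) (auto simp: the_inv_into_f_f)
  have A_eq: "?A = range (power_prod G t {1..n})"
  proof
    show "?A \<subseteq> range (power_prod G t {1..n})" using reindex by (intro image_subsetI) simp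
    show "range (power_prod G t {1..n}) \<subseteq> ?A" using unindex by (intro image_subsetI) simp
  qed
  have indep: "mult_independent G t {1..n}"
    unfolding mult_independent_def
  proof (intro allI impI ballI)
    fix \<alpha> i assume "power_prod G t {1..n} \<alpha> = \<one>" "i \<in> {1..n}"
    then have "(\<alpha> \<circ> the_inv_into {1..n} t) (t i) = 0"
      using B(2) tB unfolding unindex mult_independent_def by blast
    then show "\<alpha> i = 0" using inj \<open>i \<in> {1..n}\<close> by (simp add: the_inv_into_f_f)
  qed
  define X where "X = (S \<union> T) \<union> m_inv G ` (S \<union> T)"
  have letters: "symmetric_letters G n t \<subseteq> X"
    using tB B(1) by (auto simp: symmetric_letters_def X_def)
  have "generate G (S \<union> T) = carrier G"
    using mono_generate[of S "S \<union> T"] generate_incl[of "S \<union> T"] S T(2) by auto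
  then have X: "finite_symmetric_generating_set G X"
    unfolding X_def using S T by (intro finite_symmetric_generating_setI) auto
  then have X': "finite X" "X \<subseteq> carrier G"
    by (auto simp: finite_symmetric_generating_set_def)
  have tc: "t ` {1..n} \<subseteq> carrier G" using tB Bc by simp
  have word: "[h] \<in> lists X \<and> word_val G [h] = h" if "h \<in> T" for h
    using that T(2) by (auto simp: X_def)
  have "\<exists>f. logspace_normal_form_function_onto G X
    {concat (map (\<lambda>i. power_word G (t i) (\<alpha> i)) [1..<n + 1]) @ [h] | \<alpha> h. h \<in> T} f"
    using T(4) unfolding A_eq
    by (rule logspace_normal_form_free_by_finite[OF tc indep T(1-3) _ X' letters word])
  with X show ?thesis
    unfolding has_logspace_normal_form_function_def logspace_normal_form_function_def by blast
qed

text \<open>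
  Here the free abelian subgroup is the whole group, with transversal \<open>{\<one>}\<close>, and the
  only element of the transversal is represented by the empty word.
\<close>

theorem free_abelian_logspace_normal_form:
  assumes "free_abelian_generators G n t"
  shows "finite_symmetric_generating_set G (symmetric_letters G n t) \<and>
    (\<exists>f. logspace_normal_form_function_onto G (symmetric_letters G n t) (ordered_power_words G n t) f)"
proof
  have t: "t ` {1..n} \<subseteq> carrier G" "generate G (t ` {1..n}) = carrier G" "mult_independent G t {1..n}"
    using assms by (auto simp: free_abelian_generators_def mult_independent_def power_prod_def)
  have X: "symmetric_letters G n t = t ` {1..n} \<union> m_inv G ` t ` {1..n}"
    by (auto simp: symmetric_letters_def)
  show fin: "finite_symmetric_generating_set G (symmetric_letters G n t)"
    unfolding X using t by (intro finite_symmetric_generating_setI) auto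
  have A: "carrier G \<subseteq> range (power_prod G t {1..n})"
    using generate_subset_range_power_prod[of "{1..n}" t] t by simp
  have L: "ordered_power_words G n t =
      {concat (map (\<lambda>i. power_word G (t i) (\<alpha> i)) [1..<n + 1]) @ [] | \<alpha> h. h \<in> {\<one>}}"
    by (auto simp: ordered_power_words_def)
  show "\<exists>f. logspace_normal_form_function_onto G (symmetric_letters G n t) (ordered_power_words G n t) f"
    unfolding L using t A fin
    by (intro logspace_normal_form_free_by_finite) (auto simp: finite_symmetric_generating_set_def)
qed

end

theorem corollary14:
  fixes G :: "('a, 'b) monoid_scheme"
  assumes "comm_group G"
  shows "(finitely_generated G \<longrightarrow> has_logspace_normal_form_function G) \<and>
    (\<forall>n t. G \<cong> product_group {1..n} (\<lambda>_. integer_group) \<and> free_abelian_generators G n t \<longrightarrow>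
       finite_symmetric_generating_set G (symmetric_letters G n t) \<and>
       (\<exists>f. logspace_normal_form_function_onto G (symmetric_letters G n t)
              (ordered_power_words G n t) f))"
  using comm_group.finitely_generated_has_logspace_normal_form_function[OF assms]
    comm_group.free_abelian_logspace_normal_form[OF assms] by blast

end
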